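(* Let $\psi:[0,\lambda_{\max})\to[0,\infty)$ be a CGF-like function with $\sup_{\lambda\in[0,\lambda_{\max})}\psi'(\lambda)=\infty$, and suppose $(S_t)_{t\ge0}$ is a sub-$\psi$ process with variance proxy $(V_t)_{t\ge0}$, taking values in $\mathbb{R}^d$. Let $\alpha>1$, $\beta>1$, $\rho>0$, $\epsilon\in(0,1)$ and $\delta\in(0,1)$ be constants, and let $h:[0,\infty)\to[0,\infty)$ be an increasing function such that $\sum_{k=0}^\infty h(k)^{-1}\le1$. For a $d\times d$ positive semi-definite matrix $V$ define $$L_\rho(V):=\log\left(h\left(\log_\alpha\left(\frac{\gamma_{\max}(V\lor\rho I_d)}{\rho}\right)\right)\right)+\log\left(\frac1\delta\cdot\frac{1}{1-\beta^{-1}}\right)+\log\left(\beta\sqrt{\kappa(V\lor\rho I_d)}\cdot N_{d-1}\left(\frac{\epsilon}{\beta\sqrt{\kappa(V\lor\rho I_d)}}\right)\right).$$ If $\psi$ is super-Gaussian (meaning that $\psi(\lambda)/\lambda^2$ is a non-decreasing function of $\lambda$), then $$\mathbb{P}\left(\exists t\ge0:\left\|(V_t\lor\rho I_d)^{-1/2}S_t\right\|\ge\frac{\sqrt{\gamma_{\min}(V_t\lor\rho I_d)}}{1-\epsilon}\cdot(\psi^* )^{-1}\left(\frac{\alpha}{\gamma_{\min}(V_t\lor\rho I_d)}L_\rho(V_t)\right)\right)\le\delta.$$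
   Context: Time $t$ ranges over $\{0,1,2,\dots\}$; $\|\cdot\|$ and $\langle\cdot,\cdot\rangle$ are the Euclidean norm and inner product; $\mathbb{S}^{d-1}$ is the Euclidean unit sphere in $\mathbb{R}^d$; $a\lor b=\max\{a,b\}$. Matrices: for a $d\times d$ positive semi-definite $V$, $\gamma_{\max}(V),\gamma_{\min}(V)$ are its largest and smallest eigenvalues and $\kappa(V)=\gamma_{\max}(V)/\gamma_{\min}(V)$. If $V=\sum_n\gamma_n v_nv_n^\top$ is a spectral decomposition with orthonormal eigenvectors, $V\lor\rho I_d:=\sum_n(\gamma_n\lor\rho)v_nv_n^\top$. Covering number: $N_{d-1}(\epsilon)$ is the smallest cardinality of a set $K\subset\mathbb{S}^{d-1}$ such that every $x\in\mathbb{S}^{d-1}$ has some $y\in K$ with $\|x-y\|\le\epsilon$. CGF-like: a twice continuously differentiable function $\psi:[0,\lambda_{\max})\to[0,\infty)$ is CGF-like if it is strictly convex, $\psi(0)=\psi'(0)=0$ and $\psi''(0)>0$. Convex conjugate: $\psi^*(u)=\sup_{\lambda\in[0,\lambda_{\max})}(u\lambda-\psi(\lambda))$ for $u\in[0,\infty)$ (under $\sup\psi'=\infty$), and $(\psi^* )^{-1}$ is its inverse function. Sub-$\psi$ (vector): let $(S_t)_{t\ge0}$ be $\mathbb{R}^d$-valued and $(V_t)_{t\ge0}$ be valued in the $d\times d$ positive semi-definite matrices, both adapted to some filtration $(\mathcal{F}_t)_{t\ge0}$. $(S_t)$ is sub-$\psi$ with variance proxy $(V_t)$ if for every $\nu\in\mathbb{S}^{d-1}$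 and $\lambda\in[0,\lambda_{\max})$ there is a non-negative supermartingale $(L_t^{\lambda\cdot\nu})_{t\ge0}$ with respect to $(\mathcal{F}_t)_{t\ge0}$ such that (almost surely) $\exp\{\lambda\langle\nu,S_t\rangle-\psi(\lambda)\langle\nu,V_t\nu\rangle\}\le L_t^{\lambda\cdot\nu}$ for all $t\ge0$.
   Formalization: The dominating non-negative supermartingales in the definition of sub-ψ are additionally required to satisfy E[L_0] ≤ 1; without this, S_t = c constant with V_t = 0 would be sub-ψ for every c, and the bound fails for large c. *)

theory Defs
  imports "HOL-Probability.Probability"
begin

section \<open>Positive semi-definite matrices and their spectrum\<close>

definition psd :: "real^'n^'n \<Rightarrow> bool" where
  "psd A \<longleftrightarrow> transpose A = A \<and> (\<forall>x. 0 \<le> x \<bullet> (A *v x))"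

definition eigenvalues :: "real^'n^'n \<Rightarrow> real set" where
  "eigenvalues A = {c. \<exists>x. x \<noteq> 0 \<and> A *v x = c *\<^sub>R x}"

definition gamma_max :: "real^'n^'n \<Rightarrow> real" where
  "gamma_max A = Max (eigenvalues A)"

definition gamma_min :: "real^'n^'n \<Rightarrow> real" where
  "gamma_min A = Min (eigenvalues A)"

definition kappa :: "real^'n^'n \<Rightarrow> real" where
  "kappa A = gamma_max A / gamma_min A"

definition outer_product :: "real^'n \<Rightarrow> real^'n \<Rightarrow> real^'n^'n" where
  "outer_product x y = (\<chi> i j. x $ i * y $ j)"

definition spectral_decomposition ::
    "real^'n^'n \<Rightarrow> ('n \<Rightarrow> real) \<Rightarrow> ('n \<Rightarrow> real^'n) \<Rightarrow> bool" where
  "spectral_decomposition A g v \<longleftrightarrow>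
     (\<forall>i j. v i \<bullet> v j = (if i = j then 1 else 0)) \<and>
     A = (\<Sum>n\<in>UNIV. g n *\<^sub>R outer_product (v n) (v n))"

text \<open>
  Functional calculus for symmetric matrices: the eigenvalues are replaced by their images under
  \<open>f\<close> and the eigenvectors are kept. The value does not depend on the decomposition; see
  \<open>spectral_fun_eq\<close> below.
\<close>

definition spectral_fun :: "(real \<Rightarrow> real) \<Rightarrow> real^'n^'n \<Rightarrow> real^'n^'n" where
  "spectral_fun f A = (THE B. \<exists>g v. spectral_decomposition A g v \<and>
     B = (\<Sum>n\<in>UNIV. f (g n) *\<^sub>R outer_product (v n) (v n)))"

definition spectral_max :: "real^'n^'n \<Rightarrow> real \<Rightarrow> real^'n^'n" where
  "spectral_max A \<rho> = spectral_fun (\<lambda>\<gamma>. max \<gamma> \<rho>) A"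

text \<open>For a positive definite matrix this is the inverse of its positive definite square root.\<close>

definition inv_sqrt_matrix :: "real^'n^'n \<Rightarrow> real^'n^'n" where
  "inv_sqrt_matrix A = spectral_fun (\<lambda>\<gamma>. 1 / sqrt \<gamma>) A"

lemma outer_product_mult_vec: "outer_product x y *v z = (y \<bullet> z) *\<^sub>R x"
  by (simp add: vec_eq_iff outer_product_def matrix_vector_mult_def inner_vec_def
      sum_distrib_left mult_ac)

lemma spectral_sum_mult_vec:
  "(\<Sum>n\<in>UNIV. g n *\<^sub>R outer_product (v n) (v n)) *v z = (\<Sum>n\<in>UNIV. (g n * (v n \<bullet> z)) *\<^sub>R v n)"
  for v :: "'n::finite \<Rightarrow> real^'n"
proof -
  have "(\<Sum>n\<in>N. g n *\<^sub>R outer_product (v n) (v n)) *v z = (\<Sum>n\<in>N. (g n * (v n \<bullet> z)) *\<^sub>R v n)"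
    if "finite N" for N
    using that
    by induction (simp_all add: matrix_vector_mult_add_rdistrib outer_product_mult_vec
        scaleR_matrix_vector_assoc[symmetric])
  then show ?thesis by simp
qed

lemma spectral_fun_unique:
  fixes A :: "real^'n^'n"
  assumes 1: "spectral_decomposition A g v" and 2: "spectral_decomposition A k w"
  shows "(\<Sum>n\<in>UNIV. f (g n) *\<^sub>R outer_product (v n) (v n))
       = (\<Sum>n\<in>UNIV. f (k n) *\<^sub>R outer_product (w n) (w n))" (is "?F = ?K")
proof -
  have expand: "x = (\<Sum>n\<in>UNIV. (u n \<bullet> x) *\<^sub>R u n)"
    if u: "\<forall>i j. u i \<bullet> u j = (if i = j then 1 else 0)" for u :: "'n \<Rightarrow> real^'n" and x
  proof -
    have inj: "inj u"
      by (metis injI u zero_neq_one)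
    have po: "pairwise orthogonal (range u)"
      using u by (auto simp: pairwise_def orthogonal_def)
    have "0 \<notin> range u"
      by (metis imageE inner_zero_left u zero_neq_one)
    then have ind: "independent (range u)"
      using pairwise_orthogonal_independent[OF po] by blast
    have "card (range u) = DIM(real^'n)"
      using inj by (simp add: card_image)
    then have "span (range u) = UNIV"
      using ind by (metis card_eq_dim dim_UNIV dim_eq_full subset_UNIV order_refl dim_eq_card_independent)
    then have xs: "x \<in> span (range u)" by simp
    have "x = (\<Sum>b\<in>range u. (b \<bullet> x) *\<^sub>R b)"
      using orthonormal_basis_expand[OF po _ xs] u
      by (force simp: norm_eq_1 inner_commute)
    then show ?thesis
      by (subst (asm) sum.reindex[OF inj]) simp
  qed
  have ov: "\<forall>i j. v i \<bullet> v j = (if i = j then 1 else 0)"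
    and ow: "\<forall>i j. w i \<bullet> w j = (if i = j then 1 else 0)"
    using 1 2 by (simp_all add: spectral_decomposition_def)
  have act: "(\<Sum>n\<in>UNIV. e n *\<^sub>R outer_product (u n) (u n)) *v u j = e j *\<^sub>R u j"
    if u: "\<forall>i j. u i \<bullet> u j = (if i = j then 1 else 0)" for u :: "'n \<Rightarrow> real^'n" and e j
  proof -
    have "(\<Sum>n\<in>UNIV. (e n * (u n \<bullet> u j)) *\<^sub>R u n) = (\<Sum>n\<in>UNIV. if n = j then e j *\<^sub>R u j else 0)"
      using u by (intro sum.cong) auto
    then show ?thesis by (simp add: spectral_sum_mult_vec)
  qed
  have sym: "(\<Sum>n\<in>UNIV. (e n * (u n \<bullet> x)) *\<^sub>R u n) \<bullet> y = x \<bullet> (\<Sum>n\<in>UNIV. (e n * (u n \<bullet> y)) *\<^sub>R u n)"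
    for u :: "'n \<Rightarrow> real^'n" and e x y
    by (simp add: inner_sum_left inner_sum_right inner_commute mult_ac)
  have Av: "A *v v i = g i *\<^sub>R v i" for i
    using act[OF ov] 1 by (simp add: spectral_decomposition_def)
  have Aw: "A *v w i = k i *\<^sub>R w i" for i
    using act[OF ow] 2 by (simp add: spectral_decomposition_def)
  have "g i * (v i \<bullet> w j) = k j * (v i \<bullet> w j)" for i j
  proof -
    have "(A *v v i) \<bullet> w j = v i \<bullet> (A *v w j)"
    proof -
      have "A *v z = (\<Sum>n\<in>UNIV. (g n * (v n \<bullet> z)) *\<^sub>R v n)" for z
        using 1 by (simp only: spectral_decomposition_def spectral_sum_mult_vec)
      then show ?thesis by (simp only: sym)
    qed
    then show ?thesis by (simp add: Av Aw)
  qed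
  then have eq: "f (g i) * (v i \<bullet> w j) = f (k j) * (v i \<bullet> w j)" for i j
    by (metis mult_cancel_right)
  have "?F *v x = ?K *v x" for x
  proof -
    have Fw: "?F *v w j = ?K *v w j" for j
    proof -
      have "?F *v w j = (\<Sum>n\<in>UNIV. f (k j) *\<^sub>R ((v n \<bullet> w j) *\<^sub>R v n))"
        by (simp add: spectral_sum_mult_vec eq)
      also have "\<dots> = f (k j) *\<^sub>R w j"
        using expand[OF ov, of "w j"] by (simp only: scaleR_sum_right[symmetric])
      finally show ?thesis by (simp add: act[OF ow])
    qed
    have "?F *v (\<Sum>n\<in>UNIV. (w n \<bullet> x) *\<^sub>R w n) = ?K *v (\<Sum>n\<in>UNIV. (w n \<bullet> x) *\<^sub>R w n)"
      by (simp add: linear_sum[OF matrix_vector_mul_linear] matrix_vector_mult_scaleR Fw)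
    then show ?thesis using expand[OF ow, of x] by simp
  qed
  then show ?thesis by (simp add: matrix_eq)
qed

lemma spectral_fun_eq:
  assumes "spectral_decomposition A g v"
  shows "spectral_fun f A = (\<Sum>n\<in>UNIV. f (g n) *\<^sub>R outer_product (v n) (v n))"
  unfolding spectral_fun_def
  by (rule the_equality) (use assms spectral_fun_unique in blast)+


section \<open>Covering numbers\<close>

definition covering_number :: "'a::metric_space set \<Rightarrow> real \<Rightarrow> nat" where
  "covering_number A \<epsilon> =
     (LEAST n. \<exists>K\<subseteq>A. finite K \<and> card K = n \<and> (\<forall>x\<in>A. \<exists>y\<in>K. dist x y \<le> \<epsilon>))"


section \<open>CGF-like functions\<close>

text \<open>
  The right end point \<open>lmax\<close> may be infinite. Derivatives are relative to the domain, hence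
  one-sided at 0, and nothing is required of \<open>\<psi>\<close> outside the domain.
\<close>

definition cgf_dom :: "ereal \<Rightarrow> real set" where
  "cgf_dom lmax = {l. 0 \<le> l \<and> ereal l < lmax}"

definition deriv_on :: "real set \<Rightarrow> (real \<Rightarrow> real) \<Rightarrow> real \<Rightarrow> real" where
  "deriv_on D f x = vector_derivative f (at x within D)"

definition twice_continuously_differentiable_on :: "real set \<Rightarrow> (real \<Rightarrow> real) \<Rightarrow> bool" where
  "twice_continuously_differentiable_on D f \<longleftrightarrow>
     f differentiable_on D \<and> deriv_on D f differentiable_on D \<and>
     continuous_on D (deriv_on D (deriv_on D f))"

definition strictly_convex_on :: "real set \<Rightarrow> (real \<Rightarrow> real) \<Rightarrow> bool" where
  "strictly_convex_on D f \<longleftrightarrow> convex D \<and>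
     (\<forall>x\<in>D. \<forall>y\<in>D. x \<noteq> y \<longrightarrow>
       (\<forall>u>0. \<forall>v>0. u + v = 1 \<longrightarrow> f (u * x + v * y) < u * f x + v * f y))"

definition cgf_like :: "ereal \<Rightarrow> (real \<Rightarrow> real) \<Rightarrow> bool" where
  "cgf_like lmax \<psi> \<longleftrightarrow>
     0 < lmax \<and>
     (\<forall>l\<in>cgf_dom lmax. 0 \<le> \<psi> l) \<and>
     twice_continuously_differentiable_on (cgf_dom lmax) \<psi> \<and>
     strictly_convex_on (cgf_dom lmax) \<psi> \<and>
     \<psi> 0 = 0 \<and>
     deriv_on (cgf_dom lmax) \<psi> 0 = 0 \<and>
     deriv_on (cgf_dom lmax) (deriv_on (cgf_dom lmax) \<psi>) 0 > 0"

text \<open>The quotient is not defined at 0, so 0 is excluded.\<close>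

definition super_gaussian :: "ereal \<Rightarrow> (real \<Rightarrow> real) \<Rightarrow> bool" where
  "super_gaussian lmax \<psi> \<longleftrightarrow> mono_on (cgf_dom lmax - {0}) (\<lambda>l. \<psi> l / l\<^sup>2)"

text \<open>
  When \<open>\<psi>\<close> is CGF-like with unbounded derivative, the supremum is finite for every \<open>u \<ge> 0\<close> and the
  conjugate is a bijection of \<open>[0, \<infinity>)\<close>, so the real-valued supremum and the inverse on \<open>[0, \<infinity>)\<close> are
  the intended ones.
\<close>

definition convex_conjugate :: "ereal \<Rightarrow> (real \<Rightarrow> real) \<Rightarrow> real \<Rightarrow> real" where
  "convex_conjugate lmax \<psi> u = (SUP l\<in>cgf_dom lmax. u * l - \<psi> l)"

definition convex_conjugate_inv :: "ereal \<Rightarrow> (real \<Rightarrow> real) \<Rightarrow> real \<Rightarrow> real" where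
  "convex_conjugate_inv lmax \<psi> = the_inv_into {0..} (convex_conjugate lmax \<psi>)"


section \<open>Sub-\<open>\<psi>\<close> processes\<close>

definition filtration_of :: "'a measure \<Rightarrow> (nat \<Rightarrow> 'a measure) \<Rightarrow> bool" where
  "filtration_of M F \<longleftrightarrow> filtration (space M) F \<and> (\<forall>t. subalgebra M (F t))"

definition adapted :: "(nat \<Rightarrow> 'a measure) \<Rightarrow> (nat \<Rightarrow> 'a \<Rightarrow> 'b::topological_space) \<Rightarrow> bool" where
  "adapted F X \<longleftrightarrow> (\<forall>t. X t \<in> borel_measurable (F t))"

definition supermartingale ::
    "'a measure \<Rightarrow> (nat \<Rightarrow> 'a measure) \<Rightarrow> (nat \<Rightarrow> 'a \<Rightarrow> real) \<Rightarrow> bool" where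
  "supermartingale M F L \<longleftrightarrow>
     adapted F L \<and> (\<forall>t. integrable M (L t)) \<and>
     (\<forall>s t. s \<le> t \<longrightarrow> (AE \<omega> in M. real_cond_exp M (F s) (L t) \<omega> \<le> L s \<omega>))"

text \<open>
  As usual for sub-\<open>\<psi>\<close> processes, the dominating supermartingales are normalised by
  \<open>E[L 0] \<le> 1\<close>. Without a normalisation every constant process would be sub-\<open>\<psi>\<close> with variance
  proxy 0, via the constant supermartingale \<open>L t = exp (l * (\<nu> \<bullet> S 0))\<close>.
\<close>

definition sub_psi :: "'a measure \<Rightarrow> (nat \<Rightarrow> 'a measure) \<Rightarrow> ereal \<Rightarrow> (real \<Rightarrow> real) \<Rightarrow>
    (nat \<Rightarrow> 'a \<Rightarrow> real^'n) \<Rightarrow> (nat \<Rightarrow> 'a \<Rightarrow> real^'n^'n) \<Rightarrow> bool" where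
  "sub_psi M F lmax \<psi> S V \<longleftrightarrow>
     filtration_of M F \<and> adapted F S \<and> adapted F V \<and>
     (\<forall>t. \<forall>\<omega>\<in>space M. psd (V t \<omega>)) \<and>
     (\<forall>\<nu>\<in>sphere 0 1. \<forall>l\<in>cgf_dom lmax. \<exists>L.
        supermartingale M F L \<and> (\<forall>t. \<forall>\<omega>\<in>space M. 0 \<le> L t \<omega>) \<and>
        integral\<^sup>L M (L 0) \<le> 1 \<and>
        (AE \<omega> in M. \<forall>t. exp (l * (\<nu> \<bullet> S t \<omega>) - \<psi> l * (\<nu> \<bullet> (V t \<omega> *v \<nu>))) \<le> L t \<omega>))"


section \<open>The logarithmic term of the boundary\<close>

definition L_rho :: "(real \<Rightarrow> real) \<Rightarrow> real \<Rightarrow> real \<Rightarrow> real \<Rightarrow> real \<Rightarrow> real \<Rightarrow> real^'n^'n \<Rightarrow> real" where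
  "L_rho h \<alpha> \<beta> \<delta> \<epsilon> \<rho> V =
     ln (h (log \<alpha> (gamma_max (spectral_max V \<rho>) / \<rho>)))
     + ln (1 / \<delta> * (1 / (1 - inverse \<beta>)))
     + ln (\<beta> * sqrt (kappa (spectral_max V \<rho>))
           * real (covering_number (sphere (0::real^'n) 1)
                     (\<epsilon> / (\<beta> * sqrt (kappa (spectral_max V \<rho>))))))"

end

theory Submission
  imports Defs
begin

text \<open>
  Write \<open>W\<close> for the variance proxy with its eigenvalues raised to at least \<open>\<rho>\<close>. The norm
  \<open>\<parallel>W\<^sup>-\<^sup>1\<^sup>/\<^sup>2 S\<parallel>\<close> is the supremum of \<open>\<nu> \<bullet> S / sqrt x\<close> over unit vectors \<open>\<nu>\<close>, where \<open>x = \<nu> \<bullet> W \<nu>\<close>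
  is the variance in the direction \<open>\<nu>\<close>. So the vector statement reduces to scalar ones, provided
  that countably many scalar events suffice.

  For one direction \<open>\<nu>\<close> and one slope \<open>l\<close>, Ville's inequality for the dominating supermartingale
  bounds the probability that \<open>l * (\<nu> \<bullet> S) - \<psi> l * (\<nu> \<bullet> V \<nu>)\<close> ever reaches a level \<open>y\<close> by
  \<open>exp (- y)\<close> (\<open>sub_psi_line_crossing\<close>). Off this event \<open>\<nu> \<bullet> S < (\<psi> l * x + y) / l\<close>, and the best
  choice of \<open>l\<close> turns the right-hand side into \<open>x * conjugate_inv (y / x)\<close>. The best slope depends
  on \<open>x\<close>, which is random. One therefore uses a slope for each interval \<open>[\<rho> \<alpha>\<^sup>k, \<rho> \<alpha>\<^sup>k\<^sup>+\<^sup>1]\<close> of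
  variances and loses only a factor \<open>\<alpha>\<close> inside the inverse conjugate (\<open>line_below_conjugate_inv\<close>).

  The supremum over directions is replaced by a maximum over a net of the sphere. Normalising by
  \<open>W\<close> distorts distances by at most \<open>sqrt (kappa W)\<close>, so a mesh \<open>\<epsilon> / sqrt (kappa W)\<close> captures
  the norm up to the factor \<open>1 - \<epsilon>\<close> (\<open>net_captures_norm\<close>). The condition number is random too,
  so there is a net for each power \<open>\<beta>\<^sup>j\<close>.

  A union bound over \<open>k\<close>, \<open>j\<close> and the net, with weights summing to at most \<open>\<delta>\<close>, makes \<open>y\<close> at
  most the logarithmic term of the boundary (\<open>stitched_union_bound\<close>). What is left is a bound
  \<open>sqrt x * conjugate_inv (\<alpha> L / x)\<close> that depends on the direction through \<open>x\<close>; for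
  super-Gaussian \<open>\<psi>\<close> it does not increase with \<open>x\<close> (\<open>sqrt_conjugate_inv_antimono\<close>), and the least
  eigenvalue of \<open>W\<close> is the worst case.
\<close>

section \<open>Line crossing in a single direction\<close>

text \<open>
  Ville's inequality. Up to time \<open>n\<close> the outcomes split into those that have reached level \<open>c\<close>
  and the set \<open>B n\<close> of those that have not. Stop the process on reaching the level and count the
  stopped paths with value \<open>c\<close>, the others with \<open>L n\<close>. The expectation of this count never
  increases with \<open>n\<close>, by the supermartingale property on the event \<open>B n\<close> of \<open>F n\<close>.
\<close>

lemma supermartingale_maximal_inequality:
  assumes "prob_space M" and F: "filtration_of M F" and L: "supermartingale M F L"
    and nonneg: "\<And>t \<omega>. \<omega> \<in> space M \<Longrightarrow> 0 \<le> L t \<omega>"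
  shows "c * measure M {\<omega>\<in>space M. \<exists>t. c \<le> L t \<omega>} \<le> integral\<^sup>L M (L 0)"
proof -
  interpret prob_space M by fact
  define B where "B n = {\<omega>\<in>space M. \<forall>s\<le>n. L s \<omega> < c}" for n
  have sub: "subalgebra M (F n)" for n
    using F by (simp add: filtration_of_def)
  have LF: "L s \<in> borel_measurable (F n)" if "s \<le> n" for s n
  proof -
    have "subalgebra (F n) (F s)"
      using F that by (auto simp: filtration_of_def filtration_def subalgebra_def)
    then show ?thesis
      using L by (auto simp: supermartingale_def adapted_def intro: measurable_from_subalg)
  qed
  have BF: "B n \<in> sets (F n)" for n
  proof -
    have "B n = (\<Inter>s\<in>{..n}. {\<omega>\<in>space (F n). L s \<omega> < c})"
      using sub[of n] by (auto simp: B_def subalgebra_def)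
    moreover have "{\<omega>\<in>space (F n). L s \<omega> < c} \<in> sets (F n)" if "s \<le> n" for s
      using LF[OF that] by measurable
    ultimately show ?thesis by (simp add: sets.finite_INT)
  qed
  then have BM [measurable]: "B n \<in> sets M" for n
    using sub[of n] by (auto simp: subalgebra_def)
  have int [measurable, simp]: "integrable M (L n)" for n
    using L by (simp add: supermartingale_def)
  have intB [simp]: "integrable M (\<lambda>\<omega>. indicator (B m) \<omega> * L n \<omega>)" for m n
    using integrable_mult_indicator[OF BM int] by simp
  have decr: "(\<integral>\<omega>. indicator (B n) \<omega> * L (Suc n) \<omega> \<partial>M) \<le> (\<integral>\<omega>. indicator (B n) \<omega> * L n \<omega> \<partial>M)" for n
  proof -
    interpret fs: finite_measure_subalgebra M "F n"
      by unfold_locales (use sub in auto)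
    have ce: "integrable M (\<lambda>\<omega>. indicator (B n) \<omega> * real_cond_exp M (F n) (L (Suc n)) \<omega>)"
      using integrable_mult_indicator[OF BM fs.real_cond_exp_int(1)[OF int]] by simp
    have "(\<integral>\<omega>. indicator (B n) \<omega> * L (Suc n) \<omega> \<partial>M)
        = (\<integral>\<omega>. indicator (B n) \<omega> * real_cond_exp M (F n) (L (Suc n)) \<omega> \<partial>M)"
      using fs.real_cond_exp_intA[OF int BF] by (simp add: set_lebesgue_integral_def)
    also have "\<dots> \<le> (\<integral>\<omega>. indicator (B n) \<omega> * L n \<omega> \<partial>M)"
    proof (rule integral_mono_AE[OF ce intB])
      have "AE \<omega> in M. real_cond_exp M (F n) (L (Suc n)) \<omega> \<le> L n \<omega>"
        using L by (simp add: supermartingale_def)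
      then show "AE \<omega> in M. indicator (B n) \<omega> * real_cond_exp M (F n) (L (Suc n)) \<omega>
          \<le> indicator (B n) \<omega> * L n \<omega>"
        by eventually_elim (simp add: indicator_def)
    qed
    finally show ?thesis .
  qed
  have split: "c * indicator (A - B m) \<omega> + indicator (B m) \<omega> * L m \<omega> \<le> indicator A \<omega> * L m \<omega>"
    if "\<omega> \<in> space M" "A \<subseteq> space M" "B m \<subseteq> A" "\<And>\<omega>. \<omega> \<in> A - B m \<Longrightarrow> c \<le> L m \<omega>" for A m \<omega>
    using that nonneg[of \<omega> m] by (auto simp: indicator_def)
  \<comment> \<open>on \<open>A - B m\<close> the level has just been reached, and the mass there pays for its probability\<close>
  have split_int: "c * prob (A - B m) + (\<integral>\<omega>. indicator (B m) \<omega> * L m \<omega> \<partial>M)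
      \<le> (\<integral>\<omega>. indicator A \<omega> * L m \<omega> \<partial>M)"
    if A: "A \<in> sets M" "B m \<subseteq> A" "\<And>\<omega>. \<omega> \<in> A - B m \<Longrightarrow> c \<le> L m \<omega>" for A m
  proof -
    have [simp]: "integrable M (\<lambda>\<omega>. indicator (A - B m) \<omega> :: real)"
      using A by (simp add: less_top[symmetric] integrable_indicator_iff)
    have "c * prob (A - B m) + (\<integral>\<omega>. indicator (B m) \<omega> * L m \<omega> \<partial>M)
        = (\<integral>\<omega>. c * indicator (A - B m) \<omega> + indicator (B m) \<omega> * L m \<omega> \<partial>M)"
      using A sets.sets_into_space[of "A - B m" M] by (subst Bochner_Integration.integral_add) (auto simp: Int_absorb1 Int_absorb2)
    also have "\<dots> \<le> (\<integral>\<omega>. indicator A \<omega> * L m \<omega> \<partial>M)"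
      using A sets.sets_into_space[of A M] integrable_mult_indicator[OF A(1) int]
      by (intro integral_mono split) auto
    finally show ?thesis .
  qed
  have bound: "c * prob (space M - B n) + (\<integral>\<omega>. indicator (B n) \<omega> * L n \<omega> \<partial>M) \<le> integral\<^sup>L M (L 0)" for n
  proof (induction n)
    case 0
    have "(\<integral>\<omega>. indicator (space M) \<omega> * L 0 \<omega> \<partial>M) = integral\<^sup>L M (L 0)"
      by (intro Bochner_Integration.integral_cong) auto
    moreover have "c * prob (space M - B 0) + (\<integral>\<omega>. indicator (B 0) \<omega> * L 0 \<omega> \<partial>M)
        \<le> (\<integral>\<omega>. indicator (space M) \<omega> * L 0 \<omega> \<partial>M)"
      by (intro split_int) (auto simp: B_def)
    ultimately show ?case by simp
  next
    case (Suc n)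
    have B_anti: "B (Suc n) \<subseteq> B n" by (auto simp: B_def)
    have "prob (space M - B (Suc n)) = prob ((space M - B n) \<union> (B n - B (Suc n)))"
      using B_anti sets.sets_into_space[OF BM] by (intro arg_cong[of _ _ prob]) auto
    also have "\<dots> = prob (space M - B n) + prob (B n - B (Suc n))"
      by (intro finite_measure_Union) auto
    finally have "c * prob (space M - B (Suc n)) = c * prob (space M - B n) + c * prob (B n - B (Suc n))"
      by (simp add: algebra_simps)
    moreover have "c * prob (B n - B (Suc n)) + (\<integral>\<omega>. indicator (B (Suc n)) \<omega> * L (Suc n) \<omega> \<partial>M)
        \<le> (\<integral>\<omega>. indicator (B n) \<omega> * L (Suc n) \<omega> \<partial>M)"
      using B_anti by (intro split_int) (auto simp: B_def le_Suc_eq not_less)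
    ultimately show ?case
      using Suc decr[of n] by linarith
  qed
  have "c * prob (space M - B n) \<le> integral\<^sup>L M (L 0)" for n
  proof -
    have "0 \<le> (\<integral>\<omega>. indicator (B n) \<omega> * L n \<omega> \<partial>M)"
      using nonneg by (intro integral_nonneg_AE) auto
    then show ?thesis using bound[of n] by linarith
  qed
  moreover have "(\<lambda>n. c * prob (space M - B n)) \<longlonglongrightarrow> c * prob (\<Union>n. space M - B n)"
    by (intro tendsto_intros finite_Lim_measure_incseq) (auto simp: incseq_def B_def)
  ultimately have "c * prob (\<Union>n. space M - B n) \<le> integral\<^sup>L M (L 0)"
    by (meson LIMSEQ_le_const2)
  moreover have "(\<Union>n. space M - B n) = {\<omega>\<in>space M. \<exists>t. c \<le> L t \<omega>}"
    by (auto simp: B_def not_less) (meson order_refl linorder_not_less)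
  ultimately show ?thesis by simp
qed

text \<open>
  Ville's inequality for the dominating supermartingale at level \<open>exp a\<close>. The event is phrased
  through \<open>S\<close> and \<open>V\<close> alone, so that inclusions between such events need no exceptional null set:
  the domination, which holds only almost surely, is used here once and for all.
\<close>

lemma sub_psi_line_crossing:
  fixes S :: "nat \<Rightarrow> 'a \<Rightarrow> real^'n" and a :: real
  assumes "prob_space M" and S: "sub_psi M F lmax \<psi> S V"
    and \<nu>: "\<nu> \<in> sphere 0 1" and l: "l \<in> cgf_dom lmax"
  defines "E \<equiv> {\<omega>\<in>space M. \<exists>t. a \<le> l * (\<nu> \<bullet> S t \<omega>) - \<psi> l * (\<nu> \<bullet> (V t \<omega> *v \<nu>))}"
  shows "E \<in> sets M" and "measure M E \<le> exp (- a)"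
proof -
  interpret prob_space M by fact
  let ?X = "\<lambda>t \<omega>. l * (\<nu> \<bullet> S t \<omega>) - \<psi> l * (\<nu> \<bullet> (V t \<omega> *v \<nu>))"
  have sub: "subalgebra M (F t)" for t
    using S by (simp add: sub_psi_def filtration_of_def)
  have [measurable]: "S t \<in> borel_measurable M" "V t \<in> borel_measurable M" for t
    by (rule measurable_from_subalg[OF sub[of t]], use S in \<open>simp add: sub_psi_def adapted_def\<close>)+
  have "continuous_on UNIV (\<lambda>A::real^'n^'n. \<nu> \<bullet> (A *v \<nu>))"
    by (simp add: matrix_vector_mult_def inner_vec_def) (intro continuous_intros)
  then have [measurable]: "(\<lambda>A::real^'n^'n. \<nu> \<bullet> (A *v \<nu>)) \<in> borel_measurable borel"
    by (rule borel_measurable_continuous_onI)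
  have [measurable]: "(\<lambda>\<omega>. \<nu> \<bullet> (V t \<omega> *v \<nu>)) \<in> borel_measurable M" for t
    using measurable_compose[of "V t" M borel "\<lambda>A. \<nu> \<bullet> (A *v \<nu>)" borel] by simp
  show E: "E \<in> sets M" unfolding E_def by measurable
  obtain L where L: "supermartingale M F L" "\<And>t \<omega>. \<omega> \<in> space M \<Longrightarrow> 0 \<le> L t \<omega>"
    "integral\<^sup>L M (L 0) \<le> 1" "AE \<omega> in M. \<forall>t. exp (?X t \<omega>) \<le> L t \<omega>"
    using S \<nu> l unfolding sub_psi_def by blast
  have [measurable]: "L t \<in> borel_measurable M" for t
    using L(1) by (auto simp: supermartingale_def)
  have "AE \<omega> in M. \<omega> \<in> E \<longrightarrow> \<omega> \<in> {\<omega>\<in>space M. \<exists>t. exp a \<le> L t \<omega>}"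
    using L(4) AE_space
  proof eventually_elim
    case (elim \<omega>)
    show ?case
    proof
      assume "\<omega> \<in> E"
      then obtain t where "a \<le> ?X t \<omega>" by (auto simp: E_def)
      then have "exp a \<le> exp (?X t \<omega>)" by simp
      also have "\<dots> \<le> L t \<omega>" using elim by blast
      finally show "\<omega> \<in> {\<omega>\<in>space M. \<exists>t. exp a \<le> L t \<omega>}" using elim by blast
    qed
  qed
  then have "prob E \<le> prob {\<omega>\<in>space M. \<exists>t. exp a \<le> L t \<omega>}"
    by (intro finite_measure_mono_AE) auto
  moreover have "exp a * prob {\<omega>\<in>space M. \<exists>t. exp a \<le> L t \<omega>} \<le> integral\<^sup>L M (L 0)"
    using S by (intro supermartingale_maximal_inequality[OF \<open>prob_space M\<close> _ L(1,2)])
      (auto simp: sub_psi_def)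
  ultimately have "exp a * prob E \<le> 1"
    using L(3) mult_left_mono[of "prob E" _ "exp a"] by (meson exp_ge_zero order_trans)
  then show "prob E \<le> exp (- a)"
    by (simp add: exp_minus field_simps)
qed

section \<open>The convex conjugate of a CGF-like function\<close>

text \<open>
  Steepness makes \<open>\<psi>'\<close> a continuous map of the domain onto \<open>[0, \<infinity>)\<close>, so every \<open>u \<ge> 0\<close> is a
  slope \<open>\<psi>' l\<close>, and the supremum that defines the conjugate at \<open>u\<close> is attained at \<open>l\<close>, by
  convexity. The properties of the conjugate are read off from such a maximiser.
\<close>

locale cgf =
  fixes lmax :: ereal and \<psi> :: "real \<Rightarrow> real"
  assumes cgf_like: "cgf_like lmax \<psi>"
    and steep: "(SUP l\<in>cgf_dom lmax. ereal (deriv_on (cgf_dom lmax) \<psi> l)) = \<infinity>"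
begin

abbreviation "D \<equiv> cgf_dom lmax"
abbreviation "\<psi>' \<equiv> deriv_on D \<psi>"
abbreviation "conjugate \<equiv> convex_conjugate lmax \<psi>"
abbreviation "conjugate_inv \<equiv> convex_conjugate_inv lmax \<psi>"

lemma \<psi>_nonneg: "l \<in> D \<Longrightarrow> 0 \<le> \<psi> l" and \<psi>_zero: "\<psi> 0 = 0" and \<psi>'_zero: "\<psi>' 0 = 0"
  and zero_in_D: "0 \<in> D"
  using cgf_like by (auto simp: cgf_like_def cgf_dom_def zero_ereal_def)

lemma D_nonneg: "l \<in> D \<Longrightarrow> 0 \<le> l"
  by (simp add: cgf_dom_def)

lemma D_downward: "l \<in> D \<Longrightarrow> 0 \<le> m \<Longrightarrow> m \<le> l \<Longrightarrow> m \<in> D"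
  unfolding cgf_dom_def using le_less_trans[of "ereal m" "ereal l" lmax] by auto

lemma strictly_convex: "strictly_convex_on D \<psi>"
  using cgf_like by (simp add: cgf_like_def)

lemma strictly_convexD:
  "x \<in> D \<Longrightarrow> y \<in> D \<Longrightarrow> x \<noteq> y \<Longrightarrow> 0 < u \<Longrightarrow> 0 < v \<Longrightarrow> u + v = 1 \<Longrightarrow>
    \<psi> (u * x + v * y) < u * \<psi> x + v * \<psi> y"
  using strictly_convex by (simp add: strictly_convex_on_def)

lemma convex: "convex_on D \<psi>"
proof (rule convex_onI)
  show "convex D" using strictly_convex by (simp add: strictly_convex_on_def)
next
  fix t x y assume t: "0 < t" "t < (1::real)" and "x \<in> D" "y \<in> D"
  show "\<psi> ((1 - t) *\<^sub>R x + t *\<^sub>R y) \<le> (1 - t) * \<psi> x + t * \<psi> y"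
  proof (cases "x = y")
    case True
    then show ?thesis by (simp add: algebra_simps)
  next
    case False
    then show ?thesis
      using strictly_convexD[OF \<open>x \<in> D\<close> \<open>y \<in> D\<close> False, of "1 - t" t] t by simp
  qed
qed

lemma has_deriv: "l \<in> D \<Longrightarrow> (\<psi> has_real_derivative \<psi>' l) (at l within D)"
  using cgf_like vector_derivative_works[of \<psi> "at l within D"]
  by (simp add: cgf_like_def twice_continuously_differentiable_on_def differentiable_on_def
      deriv_on_def has_real_derivative_iff_has_vector_derivative)

lemma continuous_\<psi>: "continuous_on D \<psi>" and continuous_\<psi>': "continuous_on D \<psi>'"
  using cgf_like by (auto simp: cgf_like_def twice_continuously_differentiable_on_def
      intro: differentiable_imp_continuous_on)

lemma tangent:
  assumes l: "l \<in> D" and m: "m \<in> D"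
  shows "\<psi> l + \<psi>' l * (m - l) \<le> \<psi> m"
proof (cases "l = 0")
  case True
  then show ?thesis using \<psi>_nonneg[OF m] \<psi>_zero \<psi>'_zero by simp
next
  case False
  then have "0 < l" using D_nonneg[OF l] by simp
  obtain r where r: "ereal l < ereal r" "ereal r < lmax"
    using l ereal_dense2[of "ereal l" lmax] by (auto simp: cgf_dom_def)
  have "{0<..<r} \<subseteq> D"
  proof
    fix x assume "x \<in> {0<..<r}"
    then show "x \<in> D" using r less_trans[of "ereal x" "ereal r" lmax] by (auto simp: cgf_dom_def)
  qed
  \<comment> \<open>0 is treated apart because the general tangent bound applies at interior points\<close>
  then have "l \<in> interior D"
    using \<open>0 < l\<close> r by (intro interiorI[of "{0<..<r}"]) auto
  then have "\<psi> m - \<psi> l \<ge> \<psi>' l * (m - l)"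
    using convex_on_imp_above_tangent[OF convex _ _ m has_deriv[OF l]] l
      convex_connected[of D] strictly_convex by (simp add: strictly_convex_on_def)
  then show ?thesis by simp
qed

lemma \<psi>'_nonneg:
  assumes l: "l \<in> D" shows "0 \<le> \<psi>' l"
proof (cases "l = 0")
  case True
  then show ?thesis by (simp add: \<psi>'_zero)
next
  case False
  then have "0 < l" using D_nonneg[OF l] by simp
  moreover have "0 \<le> \<psi>' l * l"
    using tangent[OF l zero_in_D] \<psi>_nonneg[OF l] \<psi>_zero by simp
  ultimately show ?thesis by (simp add: zero_le_mult_iff)
qed

lemma conjugate_deriv: 
  assumes l: "l \<in> D" shows "conjugate (\<psi>' l) = \<psi>' l * l - \<psi> l"
  unfolding convex_conjugate_def
proof (rule cSup_eq_maximum)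
  show "\<psi>' l * l - \<psi> l \<in> (\<lambda>m. \<psi>' l * m - \<psi> m) ` D" using l by blast
  show "x \<le> \<psi>' l * l - \<psi> l" if "x \<in> (\<lambda>m. \<psi>' l * m - \<psi> m) ` D" for x
    using that tangent[OF l] by (fastforce simp: algebra_simps)
qed

lemma D_interval: "a \<in> D \<Longrightarrow> b \<in> D \<Longrightarrow> {a..b} \<subseteq> D"
  using D_downward D_nonneg by (meson atLeastAtMost_iff order_trans subsetI)

lemma deriv_unbounded: "\<exists>l\<in>D. u \<le> \<psi>' l"
proof -
  have "ereal u < (SUP l\<in>D. ereal (\<psi>' l))" using steep by simp
  then show ?thesis by (auto simp: less_SUP_iff intro: less_imp_le)
qed

lemma deriv_surj:
  assumes "0 \<le> u" shows "\<exists>l\<in>D. \<psi>' l = u"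
proof -
  obtain r where r: "r \<in> D" "u \<le> \<psi>' r" using deriv_unbounded by blast
  have "{0..r} \<subseteq> D" using D_interval zero_in_D r by blast
  then show ?thesis
    using IVT'[of \<psi>' 0 u r] assms r D_nonneg[of r] \<psi>'_zero continuous_on_subset[OF continuous_\<psi>']
    by (auto simp: subset_iff)
qed

lemma conjugate_attained:
  assumes "0 \<le> u" obtains l where "l \<in> D" "\<psi>' l = u" "conjugate u = u * l - \<psi> l"
  using deriv_surj[OF assms] conjugate_deriv by blast

lemma conjugate_upper:
  assumes "0 \<le> u" "l \<in> D" shows "u * l - \<psi> l \<le> conjugate u"
proof -
  obtain m where m: "m \<in> D" "\<psi>' m = u" "conjugate u = u * m - \<psi> m"
    using conjugate_attained[OF assms(1)] .
  then show ?thesis using tangent[OF m(1) assms(2)] by (simp add: algebra_simps)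
qed

lemma conjugate_zero: "conjugate 0 = 0"
  using conjugate_deriv[OF zero_in_D] by (simp add: \<psi>_zero \<psi>'_zero)

text \<open>
  The maximiser \<open>l\<close> is positive because \<open>\<psi>' 0 = 0\<close>. If the supremum were 0, the tangent at \<open>l\<close>
  would pass through the origin, and \<open>\<psi>\<close> would be linear on \<open>[0, l]\<close>; comparing with \<open>\<psi> (l / 2)\<close>
  contradicts strict convexity.
\<close>

lemma conjugate_pos: assumes "0 < u" shows "0 < conjugate u"
proof -
  obtain l where l: "l \<in> D" "\<psi>' l = u" "conjugate u = u * l - \<psi> l"
    using conjugate_attained[of u] assms by auto
  have "0 < l" using l assms \<psi>'_zero D_nonneg by (metis less_le)
  have half: "l / 2 \<in> D" using D_downward[OF l(1)] \<open>0 < l\<close> by simp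
  have "\<psi> (1/2 * 0 + 1/2 * l) < 1/2 * \<psi> 0 + 1/2 * \<psi> l"
    using strictly_convexD[OF zero_in_D l(1), of "1/2" "1/2"] \<open>0 < l\<close> by simp
  then have "\<psi> (l / 2) < \<psi> l / 2" by (simp add: \<psi>_zero)
  moreover have "\<psi> l - u * l / 2 \<le> \<psi> (l / 2)"
    using tangent[OF l(1) half] l(2) by (simp add: algebra_simps)
  ultimately show ?thesis using l(3) by simp
qed

lemma conjugate_strict_mono: "strict_mono_on {0..} conjugate"
proof (rule strict_mono_onI)
  fix u w :: real assume "u \<in> {0..}" "w \<in> {0..}" "u < w"
  show "conjugate u < conjugate w"
  proof (cases "u = 0")
    case True
    then show ?thesis using conjugate_zero conjugate_pos[of w] \<open>u < w\<close> by simp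
  next
    case False
    then obtain l where l: "l \<in> D" "\<psi>' l = u" "conjugate u = u * l - \<psi> l"
      using conjugate_attained[of u] \<open>u \<in> _\<close> by auto
    then have "0 < l" using False \<psi>'_zero D_nonneg by (metis less_le)
    then have "u * l < w * l" using \<open>u < w\<close> by simp
    then show ?thesis using conjugate_upper[of w l] l \<open>w \<in> _\<close> by simp
  qed
qed

text \<open>
  Along the slopes \<open>u = \<psi>' l\<close> the conjugate is \<open>\<psi>' l * l - \<psi> l\<close>, which is continuous in \<open>l\<close> and
  vanishes at 0. It is unbounded: for a fixed \<open>m > 0\<close> in the domain it is at least
  \<open>\<psi>' l * m - \<psi> m\<close>, and \<open>\<psi>'\<close> is unbounded. The intermediate value theorem does the rest.
\<close>

lemma conjugate_surj:
  assumes "0 \<le> y" shows "\<exists>u\<ge>0. conjugate u = y"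
proof -
  let ?g = "\<lambda>l. \<psi>' l * l - \<psi> l"
  obtain m where m: "m \<in> D" "1 \<le> \<psi>' m" using deriv_unbounded by blast
  then have "0 < m" using \<psi>'_zero D_nonneg[of m] by (cases "m = 0") auto
  obtain r where r: "r \<in> D" "(y + \<psi> m) / m \<le> \<psi>' r" using deriv_unbounded by blast
  then have "y + \<psi> m \<le> \<psi>' r * m" using \<open>0 < m\<close> by (simp add: field_simps)
  then have yr: "y \<le> ?g r" using tangent[OF r(1) m(1)] by (simp add: algebra_simps)
  have sub: "{0..r} \<subseteq> D" using D_interval zero_in_D r by blast
  have "continuous_on {0..r} ?g"
    by (intro continuous_intros continuous_on_subset[OF continuous_\<psi> sub]
        continuous_on_subset[OF continuous_\<psi>' sub])
  then obtain l where "l \<in> D" "?g l = y"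
    using IVT'[of ?g 0 y r] yr assms D_nonneg[OF r(1)] sub by (auto simp: \<psi>_zero)
  then show ?thesis using conjugate_deriv \<psi>'_nonneg by metis
qed

lemma conjugate_inv:
  assumes "0 \<le> y" shows "0 \<le> conjugate_inv y" "conjugate (conjugate_inv y) = y"
proof -
  have inj: "inj_on conjugate {0..}"
    using conjugate_strict_mono by (rule strict_mono_on_imp_inj_on)
  have y: "y \<in> conjugate ` {0..}" using conjugate_surj[OF assms] by auto
  show "0 \<le> conjugate_inv y" "conjugate (conjugate_inv y) = y"
    using f_the_inv_into_f[OF inj y] the_inv_into_into[OF inj y]
    by (auto simp: convex_conjugate_inv_def)
qed

lemma conjugate_inv_le:
  assumes "0 \<le> y" "0 \<le> u" "y \<le> conjugate u" shows "conjugate_inv y \<le> u"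
  using conjugate_inv[OF assms(1)] strict_mono_onD[OF conjugate_strict_mono, of u "conjugate_inv y"] assms
  by fastforce

lemma conjugate_inv_mono: "0 \<le> y \<Longrightarrow> y \<le> z \<Longrightarrow> conjugate_inv y \<le> conjugate_inv z"
  using conjugate_inv[of z] by (intro conjugate_inv_le) auto

text \<open>
  The inverse conjugate is the lower envelope \<open>conjugate_inv y = min (\<psi> l + y) / l\<close> over
  the positive \<open>l\<close> in the domain. This yields the slope at which a line crossing bound is sharp.
\<close>

lemma conjugate_inv_line:
  assumes "0 < y" obtains l where "l \<in> D" "0 < l" "\<psi> l + y = l * conjugate_inv y"
proof -
  have i: "0 \<le> conjugate_inv y" "conjugate (conjugate_inv y) = y" using conjugate_inv[of y] assms by auto
  then obtain l where l: "l \<in> D" "y = conjugate_inv y * l - \<psi> l"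
    using conjugate_attained[of "conjugate_inv y"] by metis
  then have "l \<noteq> 0" using assms \<psi>_zero by auto
  then show thesis using l D_nonneg[of l] that by (simp add: algebra_simps)
qed

text \<open>
  Super-Gaussian growth passes to the conjugate with the inequality reversed: \<open>conjugate u / u\<^sup>2\<close> is
  non-increasing. Substitute \<open>l / c\<close> for the maximiser \<open>l\<close> at \<open>c * u\<close>.
\<close>

lemma conjugate_scale:
  assumes sg: "super_gaussian lmax \<psi>" and c: "1 \<le> c" and u: "0 \<le> u"
  shows "conjugate (c * u) \<le> c\<^sup>2 * conjugate u"
proof -
  obtain l where l: "l \<in> D" "conjugate (c * u) = c * u * l - \<psi> l"
    using conjugate_attained[of "c * u"] c u by auto
  have lc: "l / c \<in> D"
    using D_downward[OF l(1), of "l / c"] D_nonneg[OF l(1)] c mult_right_mono[of 1 c l]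
    by (simp add: field_simps)
  have "c\<^sup>2 * \<psi> (l / c) \<le> \<psi> l"
  proof (cases "l = 0")
    case True then show ?thesis by (simp add: \<psi>_zero)
  next
    case False
    then have "0 < l" using D_nonneg[OF l(1)] by simp
    then have "\<psi> (l / c) / (l / c)\<^sup>2 \<le> \<psi> l / l\<^sup>2"
      using sg l(1) lc c mult_right_mono[of 1 c l] unfolding super_gaussian_def
      by (intro mono_onD[of "D - {0}" "\<lambda>l. \<psi> l / l\<^sup>2"]) (auto simp: field_simps)
    then show ?thesis using \<open>0 < l\<close> c by (simp add: field_simps)
  qed
  then have "conjugate (c * u) \<le> c\<^sup>2 * (u * (l / c) - \<psi> (l / c))"
    using l(2) c by (simp add: algebra_simps power2_eq_square)
  also have "\<dots> \<le> c\<^sup>2 * conjugate u"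
    using conjugate_upper[OF u lc] by (intro mult_left_mono) auto
  finally show ?thesis .
qed

text \<open>
  The boundary for a direction with projected variance \<open>x\<close>, normalised by \<open>sqrt x\<close>, is largest
  for the smallest variance. It is this monotonicity that lets the least eigenvalue stand for the
  variances of all directions.
\<close>

lemma sqrt_conjugate_inv_antimono:
  assumes sg: "super_gaussian lmax \<psi>" and x: "0 < g" "g \<le> x" and c: "0 \<le> c"
  shows "sqrt x * conjugate_inv (c / x) \<le> sqrt g * conjugate_inv (c / g)"
proof -
  define r where "r = sqrt (x / g)"
  have r: "1 \<le> r" "r\<^sup>2 = x / g" "sqrt x = sqrt g * r"
    using x by (auto simp: r_def real_sqrt_divide power_divide)
  let ?u = "conjugate_inv (c / g)"
  have u: "0 \<le> ?u" "conjugate ?u = c / g" using conjugate_inv[of "c / g"] c x by auto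
  have "c / g \<le> x / g * conjugate (?u / r)"
    using conjugate_scale[OF sg r(1), of "?u / r"] u r by simp
  then have "c / x \<le> conjugate (?u / r)" using x by (simp add: field_simps)
  then have "conjugate_inv (c / x) \<le> ?u / r"
    using c x u r by (intro conjugate_inv_le) auto
  then have "r * conjugate_inv (c / x) \<le> ?u" using r by (simp add: field_simps)
  then have "sqrt g * (r * conjugate_inv (c / x)) \<le> sqrt g * ?u"
    using x by (intro mult_left_mono) auto
  then show ?thesis using r(3) by (simp add: mult.assoc)
qed

end

section \<open>The spectral theorem for real symmetric matrices\<close>

lemma symmetric_inner:
  fixes A :: "real^'n^'n"
  assumes "transpose A = A" shows "(A *v x) \<bullet> y = x \<bullet> (A *v y)"
  using dot_lmul_matrix[of x A y] assms by (metis transpose_matrix_vector)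

text \<open>
  A maximiser \<open>u\<close> of the Rayleigh quotient on the subspace is an eigenvector. Perturb it in the
  direction of its residual \<open>y = A *v u - c *\<^sub>R u\<close>: by symmetry the quotient increases to first
  order by \<open>2 * t * (y \<bullet> y)\<close>, which maximality bounds by a multiple of \<open>t\<^sup>2\<close>.
\<close>

lemma symmetric_eigenvector_in_invariant_subspace:
  fixes A :: "real^'n^'n"
  assumes sym: "transpose A = A" and W: "subspace W" and inv: "\<And>x. x \<in> W \<Longrightarrow> A *v x \<in> W"
    and "w \<in> W" "w \<noteq> 0"
  shows "\<exists>u\<in>W. \<exists>c. norm u = 1 \<and> A *v u = c *\<^sub>R u"
proof -
  let ?K = "sphere 0 1 \<inter> W"
  have "compact ?K" using closed_subspace[OF W] by (intro compact_Int_closed) auto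
  moreover have "w /\<^sub>R norm w \<in> ?K" using \<open>w \<in> W\<close> \<open>w \<noteq> 0\<close> W by (simp add: subspace_scale)
  moreover have "continuous_on ?K (\<lambda>x. x \<bullet> (A *v x))"
    by (intro continuous_intros matrix_vector_mult_linear_continuous_on)
  ultimately obtain u where u: "u \<in> ?K" and max: "\<And>x. x \<in> ?K \<Longrightarrow> x \<bullet> (A *v x) \<le> u \<bullet> (A *v u)"
    using continuous_attains_sup[of ?K "\<lambda>x. x \<bullet> (A *v x)"] by blast
  define c where "c = u \<bullet> (A *v u)"
  have rayleigh: "x \<bullet> (A *v x) \<le> c * (x \<bullet> x)" if "x \<in> W" for x
  proof (cases "x = 0")
    case False
    then have "x /\<^sub>R norm x \<in> ?K" using that W by (simp add: subspace_scale)
    from max[OF this] False show ?thesis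
      by (simp add: c_def matrix_vector_mult_scaleR power2_norm_eq_inner[symmetric]
          divide_simps power2_eq_square)
  qed simp
  define y where "y = A *v u - c *\<^sub>R u"
  have y: "y \<in> W" using u W inv by (simp add: y_def subspace_diff subspace_scale)
  define b where "b = c * (y \<bullet> y) - y \<bullet> (A *v y)"
  have "0 \<le> b" using rayleigh[OF y] by (simp add: b_def)
  have quad: "2 * t * (y \<bullet> y) \<le> t\<^sup>2 * b" for t
  proof -
    have "u \<bullet> u = 1" using u by (simp add: norm_eq_1[symmetric])
    have "(u + t *\<^sub>R y) \<bullet> (A *v (u + t *\<^sub>R y)) \<le> c * ((u + t *\<^sub>R y) \<bullet> (u + t *\<^sub>R y))"
      using u y W by (intro rayleigh) (simp add: subspace_add subspace_scale)
    moreover have "u \<bullet> (A *v y) = y \<bullet> (A *v u)"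
      using symmetric_inner[OF sym, of u y] by (simp add: inner_commute)
    moreover have "y \<bullet> (A *v u) = y \<bullet> y + c * (y \<bullet> u)"
      by (subst (2) y_def) (simp add: inner_diff_right)
    ultimately show ?thesis using \<open>u \<bullet> u = 1\<close>
      by (simp add: matrix_vector_right_distrib matrix_vector_mult_scaleR inner_add_left
          inner_add_right c_def[symmetric] b_def inner_commute[of u y] algebra_simps power2_eq_square)
  qed
  have "y \<bullet> y = 0"
  proof (rule ccontr)
    assume "y \<bullet> y \<noteq> 0"
    then have "0 < y \<bullet> y" by simp
    \<comment> \<open>any \<open>t > 0\<close> with \<open>t * b < 2 * (y \<bullet> y)\<close> contradicts \<open>quad\<close>\<close>
    define t where "t = (y \<bullet> y) / (b + 1)"
    have t: "0 < t" "t * b < y \<bullet> y"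
      using \<open>0 \<le> b\<close> \<open>0 < y \<bullet> y\<close> by (auto simp: t_def divide_less_eq distrib_left simp del: inner_gt_zero_iff)
    have "t * (2 * (y \<bullet> y)) \<le> t * (t * b)"
      using quad[of t] by (simp add: power2_eq_square mult_ac)
    then have "2 * (y \<bullet> y) \<le> t * b" using t(1) by simp
    then show False using t \<open>0 < y \<bullet> y\<close> by linarith
  qed
  then have "A *v u = c *\<^sub>R u" by (simp add: y_def)
  then show ?thesis using u by auto
qed

lemma orthonormal_expand:
  fixes v :: "'n::finite \<Rightarrow> real^'n"
  assumes v: "\<forall>i j. v i \<bullet> v j = (if i = j then 1 else 0)"
  shows "(\<Sum>n\<in>UNIV. (v n \<bullet> x) *\<^sub>R v n) = x"
proof -
  have inj: "inj v" using v by (metis injI zero_neq_one)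
  have orth: "pairwise orthogonal (range v)"
    using v by (auto simp: pairwise_def orthogonal_def)
  have "0 \<notin> range v" using v by (metis imageE inner_zero_left zero_neq_one)
  then have "independent (range v)" using pairwise_orthogonal_independent[OF orth] by blast
  then have "x \<in> span (range v)"
    using card_ge_dim_independent[of "range v" UNIV] inj by (auto simp: card_image)
  then have "(\<Sum>b\<in>range v. (x \<bullet> b) *\<^sub>R b) = x"
    using orth v by (intro orthonormal_basis_expand) (auto simp: norm_eq_1)
  then show ?thesis by (simp add: sum.reindex[OF inj] inner_commute)
qed

text \<open>
  The spectral theorem. Take an orthonormal set \<open>B\<close> of eigenvectors of the largest possible size.
  Its orthogonal complement is invariant, so if it were nonzero it would contain another unit
  eigenvector. Hence \<open>B\<close> is a basis.
\<close>

lemma symmetric_spectral_decomposition: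
  fixes A :: "real^'n^'n"
  assumes sym: "transpose A = A"
  shows "\<exists>g v. spectral_decomposition A g v"
proof -
  define P where "P B \<longleftrightarrow> pairwise orthogonal B \<and> (\<forall>b\<in>B. norm b = 1 \<and> (\<exists>c. A *v b = c *\<^sub>R b))"
    for B :: "(real^'n) set"
  have indep: "independent B" if "P B" for B
    using that by (intro pairwise_orthogonal_independent) (auto simp: P_def)
  then have "card B < Suc CARD('n)" if "P B" for B
    using independent_bound[OF indep[OF that]] by simp
  moreover have "P {}" by (simp add: P_def)
  ultimately obtain B where B: "P B" and max: "\<And>B'. P B' \<Longrightarrow> card B' \<le> card B"
    using ex_has_greatest_nat[of P "{}" card "Suc CARD('n)"] by blast
  have fin: "finite B" using independent_bound[OF indep[OF B]] by simp
  define W where "W = {x. \<forall>b\<in>B. b \<bullet> x = 0}"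
  have W0: "w = 0" if "w \<in> W" for w
  proof (rule ccontr)
    assume "w \<noteq> 0"
    have sub: "subspace W" by (auto simp: W_def subspace_def inner_add_right)
    have inv: "A *v x \<in> W" if "x \<in> W" for x
    proof -
      have "b \<bullet> (A *v x) = 0" if "b \<in> B" for b
        using B that \<open>x \<in> W\<close> symmetric_inner[OF sym, of b x] by (auto simp: P_def W_def)
      then show ?thesis by (simp add: W_def)
    qed
    obtain u where u: "u \<in> W" "norm u = 1" "\<exists>c. A *v u = c *\<^sub>R u"
      using symmetric_eigenvector_in_invariant_subspace[OF sym sub inv \<open>w \<in> W\<close> \<open>w \<noteq> 0\<close>] by auto
    then have "P (insert u B)"
      using B by (auto simp: P_def W_def pairwise_insert orthogonal_def inner_commute)
    moreover have "u \<notin> B" using u by (auto simp: W_def norm_eq_1)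
    ultimately show False using max[of "insert u B"] fin by simp
  qed
  have "span B = UNIV"
  proof (rule ccontr)
    assume "span B \<noteq> UNIV"
    then obtain w where "w \<noteq> 0" "\<And>y. y \<in> span B \<Longrightarrow> orthogonal w y"
      using orthogonal_to_subspace_exists_gen[of B UNIV] by auto
    then show False using W0[of w] by (auto simp: W_def orthogonal_def inner_commute span_base)
  qed
  then have "card B = CARD('n)"
    using dim_eq_card_independent[OF indep[OF B]] dim_span[of B] by simp
  then obtain v :: "'n \<Rightarrow> real^'n" where v: "bij_betw v UNIV B"
    using finite_same_card_bij[of "UNIV::'n set" B] fin by auto
  then have vB: "v n \<in> B" for n by (auto simp: bij_betw_def)
  have ortho: "\<forall>i j. v i \<bullet> v j = (if i = j then 1 else 0)"
  proof (intro allI)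
    fix i j
    show "v i \<bullet> v j = (if i = j then 1 else 0)"
      using B vB[of i] vB[of j] bij_betw_imp_inj_on[OF v]
      by (auto simp: P_def norm_eq_1 pairwise_def orthogonal_def inj_eq)
  qed
  have "\<forall>n. \<exists>c. A *v v n = c *\<^sub>R v n" using B vB by (auto simp: P_def)
  then obtain g where g: "\<And>n. A *v v n = g n *\<^sub>R v n" by metis
  have "A = (\<Sum>n\<in>UNIV. g n *\<^sub>R outer_product (v n) (v n))"
  proof (subst matrix_eq, rule allI)
    fix x
    have "A *v x = A *v (\<Sum>n\<in>UNIV. (v n \<bullet> x) *\<^sub>R v n)"
      using orthonormal_expand[OF ortho, of x] by simp
    also have "\<dots> = (\<Sum>n\<in>UNIV. (g n * (v n \<bullet> x)) *\<^sub>R v n)"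
      by (simp add: linear_sum[OF matrix_vector_mul_linear] matrix_vector_mult_scaleR g mult.commute)
    finally show "A *v x = (\<Sum>n\<in>UNIV. g n *\<^sub>R outer_product (v n) (v n)) *v x"
      by (simp add: spectral_sum_mult_vec)
  qed
  then have "spectral_decomposition A g v" using ortho unfolding spectral_decomposition_def by blast
  then show ?thesis by blast
qed

text \<open>Coordinates with respect to the eigenvectors of a fixed decomposition.\<close>

context
  fixes A :: "real^'n^'n" and g :: "'n \<Rightarrow> real" and v :: "'n \<Rightarrow> real^'n"
  assumes sd: "spectral_decomposition A g v"
begin

lemma spectral_ortho: "\<forall>i j. v i \<bullet> v j = (if i = j then 1 else 0)"
  using sd by (simp add: spectral_decomposition_def)

lemma spectral_inner_basis_sum: "v n \<bullet> (\<Sum>m\<in>UNIV. f m *\<^sub>R v m) = f n"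
proof -
  have "v n \<bullet> (\<Sum>m\<in>UNIV. f m *\<^sub>R v m) = (\<Sum>m\<in>UNIV. if m = n then f n else 0)"
    unfolding inner_sum_right using spectral_ortho by (intro sum.cong) auto
  then show ?thesis by simp
qed

lemma spectral_mult_vec: "A *v x = (\<Sum>n\<in>UNIV. (g n * (v n \<bullet> x)) *\<^sub>R v n)"
  using sd by (simp only: spectral_decomposition_def spectral_sum_mult_vec)

lemma spectral_inner: "x \<bullet> y = (\<Sum>n\<in>UNIV. (v n \<bullet> x) * (v n \<bullet> y))"
proof -
  have "x \<bullet> y = x \<bullet> (\<Sum>n\<in>UNIV. (v n \<bullet> y) *\<^sub>R v n)"
    using orthonormal_expand[OF spectral_ortho, of y] by simp
  then show ?thesis by (simp add: inner_sum_right inner_commute mult.commute)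
qed

lemma spectral_form: "x \<bullet> (A *v y) = (\<Sum>n\<in>UNIV. g n * (v n \<bullet> x) * (v n \<bullet> y))"
  by (simp add: spectral_mult_vec inner_sum_right inner_commute mult_ac)

lemma eigenvalues_spectral: "eigenvalues A = range g"
proof
  show "eigenvalues A \<subseteq> range g"
  proof
    fix c assume "c \<in> eigenvalues A"
    then obtain x where x: "x \<noteq> 0" "A *v x = c *\<^sub>R x" by (auto simp: eigenvalues_def)
    then obtain n where n: "v n \<bullet> x \<noteq> 0"
      using orthonormal_expand[OF spectral_ortho, of x] by fastforce
    have "c * (v n \<bullet> x) = v n \<bullet> (A *v x)" by (simp add: x(2))
    also have "\<dots> = g n * (v n \<bullet> x)"
      by (simp only: spectral_mult_vec spectral_inner_basis_sum)
    finally have "c * (v n \<bullet> x) = g n * (v n \<bullet> x)" .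
    then have "c = g n" using n by simp
    then show "c \<in> range g" by blast
  qed
  show "range g \<subseteq> eigenvalues A"
  proof
    fix c assume "c \<in> range g"
    then obtain n where n: "c = g n" by blast
    have "A *v v n = (\<Sum>m\<in>UNIV. if m = n then g n *\<^sub>R v n else 0)"
      unfolding spectral_mult_vec using spectral_ortho by (intro sum.cong) auto
    then have "A *v v n = c *\<^sub>R v n" by (simp add: n)
    moreover have "v n \<noteq> 0" using spectral_ortho by (metis inner_zero_left zero_neq_one)
    ultimately show "c \<in> eigenvalues A" by (auto simp: eigenvalues_def)
  qed
qed

lemma gamma_spectral: "gamma_min A \<le> g n" "g n \<le> gamma_max A" "gamma_min A \<in> range g"
  by (simp_all add: gamma_min_def gamma_max_def eigenvalues_spectral)

lemma spectral_form_le: "x \<bullet> (A *v x) \<le> gamma_max A * (x \<bullet> x)"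
  unfolding spectral_form spectral_inner[of x x] sum_distrib_left
  by (intro sum_mono) (use gamma_spectral(2) in \<open>auto simp: mult.assoc intro!: mult_right_mono\<close>)

lemma spectral_form_ge: "gamma_min A * (x \<bullet> x) \<le> x \<bullet> (A *v x)"
  unfolding spectral_form spectral_inner[of x x] sum_distrib_left
  by (intro sum_mono) (use gamma_spectral(1) in \<open>auto simp: mult.assoc intro!: mult_right_mono\<close>)

lemma spectral_decomposition_fun: "spectral_decomposition (spectral_fun f A) (\<lambda>n. f (g n)) v"
  using spectral_fun_eq[OF sd, of f] spectral_ortho by (simp add: spectral_decomposition_def)

end

section \<open>Nets of directions\<close>

text \<open>
  Compactness provides some finite net; without one the \<open>LEAST\<close> in the definition would be
  unspecified.
\<close>

lemma covering_number_attained: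
  assumes "compact A" "0 < r"
  obtains K where "K \<subseteq> A" "finite K" "card K = covering_number A r" "\<forall>x\<in>A. \<exists>y\<in>K. dist x y \<le> r"
proof -
  have cover: "A \<subseteq> (\<Union>x\<in>A. ball x r)" using \<open>0 < r\<close> by auto
  obtain K where K: "K \<subseteq> A" "finite K" "A \<subseteq> (\<Union>x\<in>K. ball x r)"
    by (rule compactE_image[OF \<open>compact A\<close> open_ball cover])
  have "\<forall>x\<in>A. \<exists>y\<in>K. dist x y \<le> r"
  proof
    fix x assume "x \<in> A"
    then obtain y where "y \<in> K" "dist y x < r" using K(3) by auto
    then show "\<exists>y\<in>K. dist x y \<le> r" by (intro bexI[of _ y]) (auto simp: dist_commute)
  qed
  then have "\<exists>n. \<exists>K\<subseteq>A. finite K \<and> card K = n \<and> (\<forall>x\<in>A. \<exists>y\<in>K. dist x y \<le> r)"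
    using K by blast
  from LeastI_ex[OF this] show thesis
    unfolding covering_number_def[symmetric] by (elim exE conjE) (rule that)
qed

lemma covering_number_antimono:
  assumes "compact A" "0 < r" "r \<le> r'"
  shows "covering_number A r' \<le> covering_number A r"
proof -
  obtain K where K: "K \<subseteq> A" "finite K" "card K = covering_number A r" "\<forall>x\<in>A. \<exists>y\<in>K. dist x y \<le> r"
    using covering_number_attained[OF assms(1,2)] .
  then have "\<forall>x\<in>A. \<exists>y\<in>K. dist x y \<le> r'" using assms(3) by (meson order_trans)
  then show ?thesis
    unfolding covering_number_def[of A r'] using K by (intro Least_le) blast
qed

lemma covering_number_pos:
  assumes "compact A" "A \<noteq> {}" "0 < r" shows "0 < covering_number A r"
proof -
  obtain K where K: "finite K" "card K = covering_number A r" "\<forall>x\<in>A. \<exists>y\<in>K. dist x y \<le> r"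
    using covering_number_attained[OF assms(1,3)] by metis
  then have "K \<noteq> {}" using assms(2) by auto
  then show ?thesis using K by (metis card_gt_0_iff)
qed

text \<open>
  Put \<open>z = W\<^sup>-\<^sup>1 s\<close>. In the inner product \<open>x \<bullet> (W *v y)\<close>, the number \<open>\<nu> \<bullet> s\<close> is the product of
  \<open>\<nu>\<close> with \<open>z\<close>, the norm on the left-hand side is the length of \<open>z\<close>, and the square root is the
  length of \<open>\<nu>\<close>. The claim therefore says that the \<open>W\<close>-angle between \<open>\<nu>\<close> and \<open>z\<close> has cosine at
  least \<open>1 - \<epsilon>\<close>. Choose \<open>\<nu>\<close> in the net close to \<open>u = z / norm z\<close>. Passing to the \<open>W\<close>-geometry
  magnifies the distance by at most \<open>sqrt (gamma_max W)\<close>, while unit vectors have \<open>W\<close>-length at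
  least \<open>sqrt (gamma_min W)\<close>; the mesh \<open>\<epsilon> / sqrt (kappa W)\<close> compensates for the quotient. The
  polarisation identity turns the distance into the cosine.
\<close>

lemma net_captures_norm:
  fixes W :: "real^'n^'n"
  assumes sd: "spectral_decomposition W g v" and pos: "\<And>n. 0 < g n"
    and K: "K \<subseteq> sphere 0 1" and net: "\<forall>x\<in>sphere 0 1. \<exists>y\<in>K. dist x y \<le> \<epsilon> / sqrt (kappa W)"
    and \<epsilon>: "0 < \<epsilon>" "\<epsilon> < 1"
  shows "\<exists>\<nu>\<in>K. (1 - \<epsilon>) * norm (inv_sqrt_matrix W *v s) * sqrt (\<nu> \<bullet> (W *v \<nu>)) \<le> \<nu> \<bullet> s"
proof -
  let ?a = "gamma_min W" and ?b = "gamma_max W"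
  have a: "0 < ?a" using gamma_spectral(3)[OF sd] pos by auto
  have ab: "?a \<le> ?b" using gamma_spectral(1,2)[OF sd] order_trans by blast
  define z where "z = (\<Sum>n\<in>UNIV. ((v n \<bullet> s) / g n) *\<^sub>R v n)"
  have vz: "v n \<bullet> z = (v n \<bullet> s) / g n" for n
    unfolding z_def by (rule spectral_inner_basis_sum[OF sd])
  have g0: "g n \<noteq> 0" for n using pos[of n] by simp
  have Wz: "W *v z = s"
    using orthonormal_expand[OF spectral_ortho[OF sd], of s]
    by (simp add: spectral_mult_vec[OF sd] vz g0)
  let ?N = "norm (inv_sqrt_matrix W *v s)"
  have N: "?N\<^sup>2 = z \<bullet> (W *v z)"
  proof -
    note sd' = spectral_decomposition_fun[OF sd, of "\<lambda>\<gamma>. 1 / sqrt \<gamma>"]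
    have "?N\<^sup>2 = (\<Sum>n\<in>UNIV. (1 / sqrt (g n) * (v n \<bullet> s))\<^sup>2)"
      unfolding inv_sqrt_matrix_def power2_norm_eq_inner
      by (subst spectral_inner[OF sd])
        (simp add: spectral_mult_vec[OF sd'] spectral_inner_basis_sum[OF sd] power2_eq_square)
    also have "\<dots> = z \<bullet> (W *v z)"
      using pos less_imp_le[OF pos] unfolding spectral_form[OF sd]
      by (intro sum.cong) (auto simp: vz g0 power_mult_distrib power_divide power2_eq_square)
    finally show ?thesis .
  qed
  show ?thesis
  proof (cases "z = 0")
    case True
    then have "s = 0" using Wz by simp
    moreover have "K \<noteq> {}" using net by (metis empty_iff mem_sphere_0 norm_axis_1)
    ultimately show ?thesis by auto
  next
    case False
    define u where "u = z /\<^sub>R norm z"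
    have u: "u \<in> sphere 0 1" using False by (simp add: u_def)
    then obtain \<nu> where \<nu>: "\<nu> \<in> K" "dist u \<nu> \<le> \<epsilon> / sqrt (kappa W)" using net by blast
    have unit: "u \<bullet> u = 1" "\<nu> \<bullet> \<nu> = 1" using u \<nu> K by (auto simp: norm_eq_1[symmetric])
    define p where "p = sqrt (\<nu> \<bullet> (W *v \<nu>))"
    define q where "q = sqrt (u \<bullet> (W *v u))"
    have ge: "?a \<le> \<nu> \<bullet> (W *v \<nu>)" "?a \<le> u \<bullet> (W *v u)"
      using spectral_form_ge[OF sd] unit by (metis mult_1_right)+
    then have pq2: "p\<^sup>2 = \<nu> \<bullet> (W *v \<nu>)" "q\<^sup>2 = u \<bullet> (W *v u)" using a by (auto simp: p_def q_def)
    have "sqrt ?a \<le> p" "sqrt ?a \<le> q" using ge by (auto simp: p_def q_def)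
    then have apq: "?a \<le> p * q" and pq: "0 \<le> p" "0 \<le> q"
      using mult_mono[of "sqrt ?a" p "sqrt ?a" q] a order_trans[of 0 "sqrt ?a"] by auto
    have "(\<nu> - u) \<bullet> (W *v (\<nu> - u)) \<le> ?b * ((\<nu> - u) \<bullet> (\<nu> - u))"
      by (rule spectral_form_le[OF sd])
    also have "\<dots> \<le> ?b * (\<epsilon> / sqrt (kappa W))\<^sup>2"
      using \<nu>(2) a ab unfolding power2_norm_eq_inner[symmetric]
      by (intro mult_left_mono power_mono) (auto simp: dist_norm norm_minus_commute)
    also have "\<dots> = \<epsilon>\<^sup>2 * ?a" using a ab by (simp add: kappa_def power_divide field_simps)
    also have "\<dots> \<le> \<epsilon>\<^sup>2 * (p * q)" using apq by (intro mult_left_mono) auto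
    also have "\<dots> \<le> \<epsilon> * (p * q)" using \<epsilon> pq
      by (intro mult_right_mono) (auto simp: power2_eq_square mult_le_cancel_left1)
    finally have "(\<nu> - u) \<bullet> (W *v (\<nu> - u)) \<le> \<epsilon> * (p * q)" .
    moreover have "u \<bullet> (W *v \<nu>) = \<nu> \<bullet> (W *v u)"
      by (simp add: spectral_form[OF sd] mult_ac)
    \<comment> \<open>polarisation: twice the product is the sum of the squared lengths minus the squared distance\<close>
    ultimately have "p\<^sup>2 + q\<^sup>2 - \<epsilon> * (p * q) \<le> 2 * (\<nu> \<bullet> (W *v u))"
      by (simp add: matrix_vector_mult_diff_distrib inner_diff_left inner_diff_right pq2)
    moreover have "2 * (p * q) \<le> p\<^sup>2 + q\<^sup>2" using sum_squares_bound[of p q] by (simp add: mult.assoc)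
    moreover have "0 \<le> \<epsilon> * (p * q)" using \<epsilon> pq by simp
    ultimately have "(1 - \<epsilon>) * (p * q) \<le> \<nu> \<bullet> (W *v u)" by (simp add: algebra_simps)
    then have "norm z * ((1 - \<epsilon>) * (p * q)) \<le> norm z * (\<nu> \<bullet> (W *v u))"
      by (rule mult_left_mono) simp
    moreover have "norm z * (\<nu> \<bullet> (W *v u)) = \<nu> \<bullet> s"
      using False Wz by (simp add: u_def matrix_vector_mult_scaleR)
    moreover have Nq: "norm z * q = ?N"
    proof (rule power2_eq_imp_eq)
      show "(norm z * q)\<^sup>2 = ?N\<^sup>2"
        using False unfolding N power_mult_distrib pq2
        by (simp add: u_def matrix_vector_mult_scaleR power2_eq_square field_simps)
    qed (use pq in auto)
    moreover have "norm z * ((1 - \<epsilon>) * (p * q)) = (1 - \<epsilon>) * ?N * p"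
      unfolding Nq[symmetric] by (simp add: mult_ac)
    ultimately have "(1 - \<epsilon>) * ?N * p \<le> \<nu> \<bullet> s" by simp
    then show ?thesis using \<nu>(1) p_def by blast
  qed
qed

section \<open>Stitching over variance scales and meshes\<close>

lemma geometric_bracket:
  fixes b y :: real
  assumes "1 < b" "1 \<le> y"
  obtains k where "b ^ k \<le> y" "y < b ^ Suc k"
proof
  define k where "k = nat \<lfloor>log b y\<rfloor>"
  have "0 \<le> log b y" using assms by simp
  then have k: "real k \<le> log b y" "log b y < real (Suc k)"
    by (auto simp: k_def) linarith
  show "b ^ k \<le> y" using k(1) assms by (simp add: le_log_iff powr_realpow)
  show "y < b ^ Suc k"
    using k(2) assms by (simp only: log_less_iff powr_realpow[symmetric])
qed

text \<open>
  One line serves a whole range \<open>x0 \<le> x \<le> \<alpha> * x0\<close> of variances. Its slope \<open>l\<close> is optimal at the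
  lower end \<open>x0\<close>; at \<open>x\<close> it gives the value belonging to \<open>y / x0\<close> instead of \<open>y / x\<close>, and
  \<open>y / x0 \<le> \<alpha> * y / x\<close>. The projected variance \<open>w\<close> may lie below \<open>x\<close>: in the application \<open>x\<close>
  is the variance after the eigenvalues have been raised to at least \<open>\<rho>\<close>.
\<close>

lemma (in cgf) line_below_conjugate_inv:
  assumes x: "0 < x0" "x0 \<le> x" "x \<le> \<alpha> * x0" and y: "0 < y" "y \<le> L" and "1 < \<alpha>"
    and l: "l \<in> D" "0 < l" "\<psi> l + y / x0 = l * conjugate_inv (y / x0)"
    and w: "w \<le> x" and below: "l * s - \<psi> l * w < y"
  shows "s < x * conjugate_inv (\<alpha> / x * L)"
proof -
  have "l * s < \<psi> l * w + y" using below by simp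
  also have "\<dots> \<le> \<psi> l * x + y" using w \<psi>_nonneg[OF l(1)] by (simp add: mult_left_mono)
  also have "\<dots> = x * (\<psi> l + y / x)" using x by (simp add: field_simps)
  also have "\<dots> \<le> x * (\<psi> l + y / x0)" using x y by (simp add: frac_le)
  also have "\<dots> = x * (l * conjugate_inv (y / x0))" using l(3) by simp
  also have "\<dots> \<le> x * (l * conjugate_inv (\<alpha> / x * L))"
  proof -
    have "y / x0 \<le> \<alpha> / x * y" using x y by (simp add: field_simps)
    also have "\<dots> \<le> \<alpha> / x * L" using x y \<open>1 < \<alpha>\<close> by (intro mult_left_mono) auto
    finally show ?thesis using x y l by (intro mult_left_mono conjugate_inv_mono) auto
  qed
  finally have "l * s < l * (x * conjugate_inv (\<alpha> / x * L))" by (simp add: mult_ac)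
  then show ?thesis using l(2) by simp
qed

text \<open>
  The error budget is spread over the cells \<open>(k, j)\<close>: a share \<open>1 / h k\<close> for the scale \<open>k\<close> of the
  variance, a geometric share \<open>(1 - 1 / \<beta>) / \<beta> ^ j\<close> for the mesh \<open>j\<close>, and an equal share for each
  direction in the net \<open>K j\<close>.
\<close>

lemma (in prob_space) stitched_union_bound:
  fixes E :: "nat \<Rightarrow> nat \<Rightarrow> 'b \<Rightarrow> 'a set" and h :: "nat \<Rightarrow> real"
  assumes E: "\<And>k j \<nu>. \<nu> \<in> K j \<Longrightarrow> E k j \<nu> \<in> events"
    and prob: "\<And>k j \<nu>. \<nu> \<in> K j \<Longrightarrow> prob (E k j \<nu>) \<le> \<delta> * (1 - inverse \<beta>) / (h k * \<beta> ^ j * card (K j))"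
    and K: "\<And>j. finite (K j)" "\<And>j. K j \<noteq> {}"
    and "1 < \<beta>" "0 < \<delta>" and h: "\<And>k. 0 < h k" "(\<Sum>k. inverse (ennreal (h k))) \<le> 1"
  shows "(\<Union>k j. \<Union>\<nu>\<in>K j. E k j \<nu>) \<in> events" "prob (\<Union>k j. \<Union>\<nu>\<in>K j. E k j \<nu>) \<le> \<delta>"
proof -
  let ?U = "\<lambda>k j. \<Union>\<nu>\<in>K j. E k j \<nu>"
  have U: "?U k j \<in> events" for k j using E K(1) by (intro sets.finite_UN) auto
  then have U': "(\<Union>j. ?U k j) \<in> events" for k by blast
  then show "(\<Union>k j. ?U k j) \<in> events" by blast
  \<comment> \<open>summing over the directions cancels the cardinality of the net\<close>
  have cell: "emeasure M (?U k j) \<le> ennreal (inverse (h k) * (\<delta> * (1 - inverse \<beta>) * inverse \<beta> ^ j))" for k j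
  proof -
    have "prob (?U k j) \<le> (\<Sum>\<nu>\<in>K j. prob (E k j \<nu>))"
      using E K by (intro finite_measure_subadditive_finite) auto
    also have "\<dots> \<le> (\<Sum>\<nu>\<in>K j. \<delta> * (1 - inverse \<beta>) / (h k * \<beta> ^ j * card (K j)))"
      by (intro sum_mono prob)
    also have "\<dots> = inverse (h k) * (\<delta> * (1 - inverse \<beta>) * inverse \<beta> ^ j)"
      using K[of j] h(1)[of k] \<open>1 < \<beta>\<close> by (simp add: field_simps)
    finally show ?thesis by (simp add: emeasure_eq_measure ennreal_leI)
  qed
  have row: "emeasure M (\<Union>j. ?U k j) \<le> ennreal \<delta> * inverse (ennreal (h k))" for k
  proof -
    have "(\<lambda>j. inverse (h k) * (\<delta> * (1 - inverse \<beta>)) * inverse \<beta> ^ j) sums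
        (inverse (h k) * (\<delta> * (1 - inverse \<beta>)) * (1 / (1 - inverse \<beta>)))"
      using \<open>1 < \<beta>\<close> by (intro sums_mult geometric_sums) (simp add: field_simps)
    moreover have "inverse \<beta> \<noteq> 1" using \<open>1 < \<beta>\<close> by simp
    ultimately have "(\<lambda>j. inverse (h k) * (\<delta> * (1 - inverse \<beta>) * inverse \<beta> ^ j)) sums (inverse (h k) * \<delta>)"
      by (simp add: mult.assoc)
    moreover have "0 \<le> inverse (h k) * (\<delta> * (1 - inverse \<beta>) * inverse \<beta> ^ j)" for j
      using \<open>1 < \<beta>\<close> \<open>0 < \<delta>\<close> h(1)[of k] by (simp add: field_simps)
    ultimately have "(\<Sum>j. ennreal (inverse (h k) * (\<delta> * (1 - inverse \<beta>) * inverse \<beta> ^ j))) = ennreal (inverse (h k) * \<delta>)"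
      by (rule suminf_ennreal_eq[rotated])
    moreover have "emeasure M (\<Union>j. ?U k j) \<le> (\<Sum>j. emeasure M (?U k j))"
      using U by (intro emeasure_subadditive_countably) auto
    moreover have "(\<Sum>j. emeasure M (?U k j)) \<le> (\<Sum>j. ennreal (inverse (h k) * (\<delta> * (1 - inverse \<beta>) * inverse \<beta> ^ j)))"
      by (intro suminf_le cell) auto
    ultimately show ?thesis
      using h(1)[of k] \<open>0 < \<delta>\<close> by (simp add: inverse_ennreal ennreal_mult mult.commute)
  qed
  have "emeasure M (\<Union>k j. ?U k j) \<le> (\<Sum>k. emeasure M (\<Union>j. ?U k j))"
    using U' by (intro emeasure_subadditive_countably) auto
  also have "\<dots> \<le> (\<Sum>k. ennreal \<delta> * inverse (ennreal (h k)))"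
    by (intro suminf_le row) auto
  also have "\<dots> = ennreal \<delta> * (\<Sum>k. inverse (ennreal (h k)))" by simp
  also have "\<dots> \<le> ennreal \<delta> * 1" by (intro mult_left_mono h) auto
  finally show "prob (\<Union>k j. ?U k j) \<le> \<delta>"
    using \<open>0 < \<delta>\<close> by (simp add: emeasure_eq_measure)
qed

theorem theorem4p1:
  fixes M :: "'a measure"
    and F :: "nat \<Rightarrow> 'a measure"
    and S :: "nat \<Rightarrow> 'a \<Rightarrow> real^'n"
    and V :: "nat \<Rightarrow> 'a \<Rightarrow> real^'n^'n"
    and lmax :: ereal
    and \<psi> h :: "real \<Rightarrow> real"
    and \<alpha> \<beta> \<rho> \<epsilon> \<delta> :: real
  assumes "prob_space M"
    and "cgf_like lmax \<psi>"
    and "(SUP l\<in>cgf_dom lmax. ereal (deriv_on (cgf_dom lmax) \<psi> l)) = \<infinity>"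
    and "sub_psi M F lmax \<psi> S V"
    and "\<alpha> > 1" and "\<beta> > 1" and "\<rho> > 0" and "0 < \<epsilon>" and "\<epsilon> < 1" and "0 < \<delta>" and "\<delta> < 1"
    and "\<forall>x\<ge>0. 0 \<le> h x"
    and "mono_on {0..} h"
    and "(\<Sum>k. inverse (ennreal (h (real k)))) \<le> 1"
    and "super_gaussian lmax \<psi>"
  shows "\<P>(\<omega> in M. \<exists>t.
           norm (inv_sqrt_matrix (spectral_max (V t \<omega>) \<rho>) *v S t \<omega>)
             \<ge> sqrt (gamma_min (spectral_max (V t \<omega>) \<rho>)) / (1 - \<epsilon>)
               * convex_conjugate_inv lmax \<psi>
                   (\<alpha> / gamma_min (spectral_max (V t \<omega>) \<rho>) * L_rho h \<alpha> \<beta> \<delta> \<epsilon> \<rho> (V t \<omega>)))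
         \<le> \<delta>"
proof -
  interpret prob_space M by fact
  interpret cgf lmax \<psi> using assms(2,3) by (simp add: cgf_def)
  note \<alpha> = \<open>\<alpha> > 1\<close> and \<beta> = \<open>\<beta> > 1\<close> and \<rho> = \<open>\<rho> > 0\<close> and \<epsilon> = \<open>0 < \<epsilon>\<close> \<open>\<epsilon> < 1\<close>
    and \<delta> = \<open>0 < \<delta>\<close> \<open>\<delta> < 1\<close>
  let ?N = "covering_number (sphere (0::real^'n) 1)"
  have sphere: "compact (sphere (0::real^'n) 1)" "sphere (0::real^'n) 1 \<noteq> {}" by auto
  have h1: "1 \<le> h (real k)" for k
  proof -
    have "inverse (ennreal (h (real k))) \<le> 1"
      using sum_le_suminf[of "\<lambda>k. inverse (ennreal (h (real k)))" "{k}"] assms(14) by auto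
    moreover have "0 \<le> h (real k)" using assms(12) by simp
    ultimately show ?thesis
      by (cases "h (real k) = 0") (auto simp: inverse_ennreal inverse_le_1_iff top_unique)
  qed
  have Npos: "1 \<le> ?N r" if "0 < r" for r
    using covering_number_pos[OF sphere that] by simp
  have r: "0 < \<epsilon> / \<beta> ^ j" for j using \<epsilon> \<beta> by simp
  have "\<forall>j. \<exists>K. K \<subseteq> sphere (0::real^'n) 1 \<and> finite K \<and> card K = ?N (\<epsilon> / \<beta> ^ j) \<and>
      (\<forall>x\<in>sphere 0 1. \<exists>y\<in>K. dist x y \<le> \<epsilon> / \<beta> ^ j)"
    using covering_number_attained[OF sphere(1) r] by metis
  then obtain K :: "nat \<Rightarrow> (real^'n) set" where K: "\<And>j. K j \<subseteq> sphere 0 1" "\<And>j. finite (K j)"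
    "\<And>j. card (K j) = ?N (\<epsilon> / \<beta> ^ j)" "\<And>j. \<forall>x\<in>sphere 0 1. \<exists>y\<in>K j. dist x y \<le> \<epsilon> / \<beta> ^ j"
    by metis
  \<comment> \<open>\<open>\<pi> k j\<close> is the share of the error spent on one direction of the cell \<open>(k, j)\<close>, and \<open>y k j\<close> the level that is crossed with at most this probability\<close>
  define \<pi> where "\<pi> k j = \<delta> * (1 - inverse \<beta>) / (h (real k) * \<beta> ^ j * card (K j))" for k j
  define y where "y k j = - ln (\<pi> k j)" for k j
  have cellpos: "1 \<le> h (real k) * \<beta> ^ j * card (K j)" for k j
  proof -
    have "1 * 1 * 1 \<le> h (real k) * \<beta> ^ j * card (K j)"
      using h1[of k] \<beta> Npos[OF r, of j] by (intro mult_mono) (auto simp: K(3))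
    then show ?thesis by simp
  qed
  have \<delta>\<beta>: "0 < \<delta> * (1 - inverse \<beta>)" "\<delta> * (1 - inverse \<beta>) < 1"
    using \<delta> \<beta> mult_strict_mono[of \<delta> 1 "1 - inverse \<beta>" 1] by (auto simp: field_simps)
  have \<pi>: "0 < \<pi> k j" "\<pi> k j < 1" for k j
    using \<delta>\<beta> cellpos[of k j] by (auto simp: \<pi>_def divide_less_eq_1)
  then have y: "0 < y k j" "exp (- y k j) = \<pi> k j" for k j by (auto simp: y_def)
  have ypos: "0 < y k j / (\<rho> * \<alpha> ^ k)" for k j using y \<rho> \<alpha> by simp
  \<comment> \<open>slope of the line for the cell, optimal at its smallest variance \<open>\<rho> * \<alpha> ^ k\<close>\<close>
  have "\<forall>k j. \<exists>l. l \<in> D \<and> 0 < l \<and>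
      \<psi> l + y k j / (\<rho> * \<alpha> ^ k) = l * conjugate_inv (y k j / (\<rho> * \<alpha> ^ k))"
    using conjugate_inv_line[OF ypos] by metis
  then obtain l where "\<forall>k j. l k j \<in> D \<and> 0 < l k j \<and>
      \<psi> (l k j) + y k j / (\<rho> * \<alpha> ^ k) = l k j * conjugate_inv (y k j / (\<rho> * \<alpha> ^ k))"
    unfolding choice_iff by blast
  then have l: "\<And>k j. l k j \<in> D" "\<And>k j. 0 < l k j"
    "\<And>k j. \<psi> (l k j) + y k j / (\<rho> * \<alpha> ^ k) = l k j * conjugate_inv (y k j / (\<rho> * \<alpha> ^ k))"
    by blast+
  define E where "E k j \<nu> = {\<omega>\<in>space M. \<exists>t.
      y k j \<le> l k j * (\<nu> \<bullet> S t \<omega>) - \<psi> (l k j) * (\<nu> \<bullet> (V t \<omega> *v \<nu>))}" for k j \<nu>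
  have E: "E k j \<nu> \<in> events" "prob (E k j \<nu>) \<le> \<pi> k j" if "\<nu> \<in> K j" for k j \<nu>
    using sub_psi_line_crossing[OF \<open>prob_space M\<close> assms(4) _ l(1)[of k j], of \<nu> "y k j"] that K(1)[of j]
    unfolding E_def y(2)[of k j, symmetric] by blast+
  have Kne: "K j \<noteq> {}" for j using K(3)[of j] Npos[OF r, of j] by auto
  have hpos: "0 < h (real k)" for k using h1[of k] by simp
  note U = stitched_union_bound[of K E \<delta> \<beta> "\<lambda>k. h (real k)",
      OF E(1) E(2)[unfolded \<pi>_def] K(2) Kne \<beta> \<delta>(1) hpos assms(14)]
  \<comment> \<open>the rest of the argument concerns a single outcome and time: a crossing of the boundary forces a crossing of one of the lines\<close>
  have bad: "\<omega> \<in> (\<Union>k j. \<Union>\<nu>\<in>K j. E k j \<nu>)"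
    if \<omega>: "\<omega> \<in> space M" and cross: "sqrt (gamma_min (spectral_max (V t \<omega>) \<rho>)) / (1 - \<epsilon>)
        * conjugate_inv (\<alpha> / gamma_min (spectral_max (V t \<omega>) \<rho>) * L_rho h \<alpha> \<beta> \<delta> \<epsilon> \<rho> (V t \<omega>))
      \<le> norm (inv_sqrt_matrix (spectral_max (V t \<omega>) \<rho>) *v S t \<omega>)" for \<omega> t
  proof (rule ccontr)
    assume notin: "\<omega> \<notin> (\<Union>k j. \<Union>\<nu>\<in>K j. E k j \<nu>)"
    define W where "W = spectral_max (V t \<omega>) \<rho>"
    define L where "L = L_rho h \<alpha> \<beta> \<delta> \<epsilon> \<rho> (V t \<omega>)"
    let ?norm = "norm (inv_sqrt_matrix W *v S t \<omega>)"
    have "transpose (V t \<omega>) = V t \<omega>"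
      using assms(4) \<omega> by (auto simp: sub_psi_def psd_def)
    then obtain g v where sdV: "spectral_decomposition (V t \<omega>) g v"
      using symmetric_spectral_decomposition by blast
    then have sd: "spectral_decomposition W (\<lambda>n. max (g n) \<rho>) v"
      unfolding W_def spectral_max_def by (rule spectral_decomposition_fun)
    have gmin: "\<rho> \<le> gamma_min W" using gamma_spectral(3)[OF sd] by auto
    have gmm: "gamma_min W \<le> gamma_max W" using gamma_spectral(1,2)[OF sd] order_trans by blast
    then have \<kappa>: "1 \<le> sqrt (kappa W)" using gmin \<rho> by (simp add: kappa_def)
    obtain i where i: "\<beta> ^ i \<le> sqrt (kappa W)" "sqrt (kappa W) < \<beta> ^ Suc i"
      using geometric_bracket[OF \<beta> \<kappa>] .
    \<comment> \<open>rounding the condition number up makes the net fine enough, at the price of the factor \<open>\<beta>\<close>\<close>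
    define j where "j = Suc i"
    have j: "sqrt (kappa W) \<le> \<beta> ^ j" "\<beta> ^ j \<le> \<beta> * sqrt (kappa W)"
      using i \<beta> by (auto simp: j_def)
    have "\<epsilon> / \<beta> ^ j \<le> \<epsilon> / sqrt (kappa W)"
      using j \<kappa> \<epsilon> \<beta> by (intro divide_left_mono) auto
    then have net: "\<forall>x\<in>sphere 0 1. \<exists>y\<in>K j. dist x y \<le> \<epsilon> / sqrt (kappa W)"
      using K(4)[of j] order_trans by blast
    obtain \<nu> where \<nu>: "\<nu> \<in> K j" "(1 - \<epsilon>) * ?norm * sqrt (\<nu> \<bullet> (W *v \<nu>)) \<le> \<nu> \<bullet> S t \<omega>"
      using net_captures_norm[OF sd _ K(1) net \<epsilon>, of "S t \<omega>"] \<rho> by (auto simp: max.strict_coboundedI2)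
    have unit: "\<nu> \<bullet> \<nu> = 1" using \<nu>(1) K(1)[of j] by (auto simp: norm_eq_1[symmetric])
    define x where "x = \<nu> \<bullet> (W *v \<nu>)"
    have x: "gamma_min W \<le> x" "x \<le> gamma_max W"
      using spectral_form_ge[OF sd, of \<nu>] spectral_form_le[OF sd, of \<nu>] unit by (auto simp: x_def)
    have "0 < x" using x gmin \<rho> by simp
    have Vx: "\<nu> \<bullet> (V t \<omega> *v \<nu>) \<le> x"
      unfolding x_def spectral_form[OF sd] spectral_form[OF sdV] mult.assoc
      by (intro sum_mono mult_right_mono) auto
    \<comment> \<open>the scale is that of the projected variance \<open>x\<close>; it is at most the scale of the largest eigenvalue, where \<open>h\<close> is evaluated in the boundary\<close>
    obtain k where k: "\<alpha> ^ k \<le> x / \<rho>" "x / \<rho> < \<alpha> ^ Suc k"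
      using geometric_bracket[OF \<alpha>, of "x / \<rho>"] x gmin \<rho> by (auto simp: field_simps)
    have yL: "y k j \<le> L"
    proof -
      have "real k \<le> log \<alpha> (gamma_max W / \<rho>)"
      proof -
        have "\<alpha> ^ k \<le> gamma_max W / \<rho>"
          using k(1) x(2) \<rho> by (meson divide_right_mono less_imp_le order_trans)
        then show ?thesis using \<alpha> x(2) \<open>0 < x\<close> \<rho> by (simp add: le_log_iff powr_realpow)
      qed
      then have "h (real k) \<le> h (log \<alpha> (gamma_max W / \<rho>))"
        using assms(13) by (intro mono_onD[of "{0..}" h]) auto
      then have 1: "ln (h (real k)) \<le> ln (h (log \<alpha> (gamma_max W / \<rho>)))"
        using h1[of k] by simp
      have r': "0 < \<epsilon> / (\<beta> * sqrt (kappa W))" using \<epsilon> \<beta> \<kappa> by simp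
      have "?N (\<epsilon> / \<beta> ^ j) \<le> ?N (\<epsilon> / (\<beta> * sqrt (kappa W)))"
        using j \<epsilon> \<beta> \<kappa> by (intro covering_number_antimono[OF sphere(1) r'] divide_left_mono) auto
      then have "\<beta> ^ j * card (K j) \<le> \<beta> * sqrt (kappa W) * ?N (\<epsilon> / (\<beta> * sqrt (kappa W)))"
        using j \<beta> \<kappa> by (intro mult_mono) (auto simp: K(3))
      moreover have "0 < \<beta> ^ j * card (K j)" using \<beta> Kne K(2) by (simp add: card_gt_0_iff)
      ultimately have 2: "ln (\<beta> ^ j * card (K j)) \<le> ln (\<beta> * sqrt (kappa W) * ?N (\<epsilon> / (\<beta> * sqrt (kappa W))))"
        by simp
      have "y k j = ln (h (real k) * (1 / \<delta> * (1 / (1 - inverse \<beta>))) * (\<beta> ^ j * card (K j)))"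
        using \<pi>(1)[of k j] by (simp add: y_def ln_inverse[symmetric] \<pi>_def mult_ac divide_simps)
      also have "\<dots> = ln (h (real k)) + ln (1 / \<delta> * (1 / (1 - inverse \<beta>))) + ln (\<beta> ^ j * card (K j))"
      proof -
        have "0 < h (real k)" using h1[of k] by simp
        moreover have "0 < 1 / \<delta> * (1 / (1 - inverse \<beta>))" using \<delta> \<beta> by (simp add: field_simps)
        ultimately show ?thesis using \<open>0 < \<beta> ^ j * card (K j)\<close> by (simp only: ln_mult_pos mult_pos_pos)
      qed
      also have "\<dots> \<le> L" unfolding L_def L_rho_def W_def[symmetric] using 1 2 by simp
      finally show ?thesis .
    qed
    have "l k j * (\<nu> \<bullet> S t \<omega>) - \<psi> (l k j) * (\<nu> \<bullet> (V t \<omega> *v \<nu>)) < y k j"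
      using notin \<nu>(1) \<omega> by (auto simp: E_def not_le)
    then have "\<nu> \<bullet> S t \<omega> < x * conjugate_inv (\<alpha> / x * L)"
      using k \<rho> \<alpha> by (intro line_below_conjugate_inv[OF _ _ _ y(1) yL \<alpha> l Vx]) (auto simp: field_simps)
    also have "\<dots> = sqrt x * (sqrt x * conjugate_inv (\<alpha> / x * L))"
      using \<open>0 < x\<close> by (simp only: mult.assoc[symmetric]) simp
    finally have "sqrt x * ((1 - \<epsilon>) * ?norm) < sqrt x * (sqrt x * conjugate_inv (\<alpha> / x * L))"
      using \<nu>(2) unfolding x_def[symmetric] by (simp only: mult.commute[of _ "sqrt x"])
    then have "(1 - \<epsilon>) * ?norm < sqrt x * conjugate_inv (\<alpha> / x * L)"
      using \<open>0 < x\<close> by (simp only: mult_less_cancel_left_pos real_sqrt_gt_zero)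
    also have "\<dots> = sqrt x * conjugate_inv (\<alpha> * L / x)" by simp
    also have "\<dots> \<le> sqrt (gamma_min W) * conjugate_inv (\<alpha> * L / gamma_min W)"
      using gmin \<rho> x y(1)[of k j] yL \<alpha> by (intro sqrt_conjugate_inv_antimono assms(15)) auto
    finally have "?norm < sqrt (gamma_min W) / (1 - \<epsilon>) * conjugate_inv (\<alpha> / gamma_min W * L)"
      using \<epsilon> by (simp add: field_simps)
    then show False using cross by (simp add: W_def L_def)
  qed
  have "prob {\<omega>\<in>space M. \<exists>t. sqrt (gamma_min (spectral_max (V t \<omega>) \<rho>)) / (1 - \<epsilon>)
        * conjugate_inv (\<alpha> / gamma_min (spectral_max (V t \<omega>) \<rho>) * L_rho h \<alpha> \<beta> \<delta> \<epsilon> \<rho> (V t \<omega>))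
      \<le> norm (inv_sqrt_matrix (spectral_max (V t \<omega>) \<rho>) *v S t \<omega>)}
    \<le> prob (\<Union>k j. \<Union>\<nu>\<in>K j. E k j \<nu>)"
    using bad U(1) by (intro finite_measure_mono) blast+
  then show ?thesis using U(2) by simp
qed

end
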